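(* Let $r\ge 3$, let $q$ be a prime power and let $\mathcal L$ be an $m$-cover of lines of $\mathrm{PG}(r,q)$. Embed $\mathrm{PG}(r,q)$ in $\mathrm{PG}(r,q^2)$ and let $\bar{\mathcal L}$ be the set of points of $\mathrm{PG}(r,q^2)$ lying on the extended lines of $\mathcal L$. Then $\bar{\mathcal L}$ is a two-character set of $\mathrm{PG}(r,q^2)$ if and only if $\mathcal L$ is an $(r-2)$-dual $m$-cover of $\mathrm{PG}(r,q)$.
   Context: An $n$-space is an $n$-dimensional projective subspace. $\theta_{n,q}=q^n+\dots+q+1$ for $n\ge 0$ and $\theta_{-1,q}=0$. An $m$-cover of lines of $\mathrm{PG}(r,q)$ is a set $\mathcal L$ of lines of $\mathrm{PG}(r,q)$ such that every point of $\mathrm{PG}(r,q)$ lies on exactly $m$ lines of $\mathcal L$, where $0<m<\theta_{r-1,q}$. An $m$-cover $\mathcal L$ of $\mathrm{PG}(r,q)$ is an $(r-2)$-dual $m$-cover if every $(r-2)$-space of $\mathrm{PG}(r,q)$ contains either $\frac{m\theta_{r-4,q}}{q+1}+q^{r-3}$ or $\frac{m\theta_{r-4,q}}{q+1}$ lines of $\mathcal L$. $\mathrm{PG}(r,q)$ is embedded in $\mathrm{PG}(r,q^2)$ in the natural way (by extending scalars from $\mathbb F_q$ to $\mathbb F_{q^2}$). The extended line of a line $\ell$ of $\mathrm{PG}(r,q)$ is the unique line of $\mathrm{PG}(r,q^2)$ meeting $\mathrm{PG}(r,q)$ in the $q+1$ points of $\ell$. A two-character set of $\mathrm{PG}(n,q)$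 is a set of points whose intersection sizes with the hyperplanes take exactly two values. *)

theory Defs
  imports "HOL-Analysis.Cartesian_Space"
begin

text \<open>
  $\mathrm{PG}(r,q)$ is the lattice of subspaces of \<open>'k ^ 'n\<close>, where \<open>'k\<close> is a field with \<open>q\<close>
  elements and \<open>'n\<close> is an index type with \<open>r + 1\<close> elements. An \<open>n\<close>-space is a linear subspace of
  dimension \<open>n + 1\<close>, and incidence is inclusion.
\<close>

definition n_spaces :: "nat \<Rightarrow> ('k::field ^ 'n) set set" where
  "n_spaces n = {U. vec.subspace U \<and> vec.dim U = n + 1}"

abbreviation proj_points :: "('k::field ^ 'n) set set" where
  "proj_points \<equiv> n_spaces 0"

abbreviation proj_lines :: "('k::field ^ 'n) set set" where
  "proj_lines \<equiv> n_spaces 1"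

text \<open>The index is an integer so that the value at \<open>-1\<close>, the empty sum, is available.\<close>

definition theta :: "int \<Rightarrow> nat \<Rightarrow> nat" where
  "theta n q = (\<Sum>i<nat (n + 1). q ^ i)"

definition m_cover :: "nat \<Rightarrow> nat \<Rightarrow> nat \<Rightarrow> ('k::field ^ 'n) set set \<Rightarrow> bool" where
  "m_cover r q m L \<longleftrightarrow>
     L \<subseteq> proj_lines \<and> 0 < m \<and> m < theta (int r - 1) q \<and>
     (\<forall>P\<in>proj_points. card {l \<in> L. P \<subseteq> l} = m)"

definition dual_m_cover :: "nat \<Rightarrow> nat \<Rightarrow> nat \<Rightarrow> ('k::field ^ 'n) set set \<Rightarrow> bool" where
  "dual_m_cover r q m L \<longleftrightarrow>
     m_cover r q m L \<and>
     (\<forall>U\<in>n_spaces (r - 2).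
        real (card {l \<in> L. l \<subseteq> U}) =
          real m * real (theta (int r - 4) q) / real (q + 1) + real q ^ (r - 3) \<or>
        real (card {l \<in> L. l \<subseteq> U}) =
          real m * real (theta (int r - 4) q) / real (q + 1))"

definition two_character_set :: "nat \<Rightarrow> ('k::field ^ 'n) set set \<Rightarrow> bool" where
  "two_character_set n S \<longleftrightarrow>
     S \<subseteq> proj_points \<and>
     card ((\<lambda>H. card {P \<in> S. P \<subseteq> H}) ` n_spaces (n - 1)) = 2"

text \<open>Injectivity is automatic for a unital ring homomorphism between fields.\<close>

definition field_embedding :: "('k::field \<Rightarrow> 'l::field) \<Rightarrow> bool" where
  "field_embedding \<iota> \<longleftrightarrow>
     \<iota> 1 = 1 \<and> (\<forall>x y. \<iota> (x + y) = \<iota> x + \<iota> y) \<and> (\<forall>x y. \<iota> (x * y) = \<iota> x * \<iota> y)"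

definition embed_point :: "('k::field \<Rightarrow> 'l::field) \<Rightarrow> ('k ^ 'n) set \<Rightarrow> ('l ^ 'n) set" where
  "embed_point \<iota> P = vec.span ((\<lambda>v. \<chi> i. \<iota> (v $ i)) ` P)"

definition extended_line :: "('k::field \<Rightarrow> 'l::field) \<Rightarrow> ('k ^ 'n) set \<Rightarrow> ('l ^ 'n) set" where
  "extended_line \<iota> l =
     (THE g. g \<in> proj_lines \<and>
        {Q \<in> embed_point \<iota> ` proj_points. Q \<subseteq> g} = embed_point \<iota> ` {P \<in> proj_points. P \<subseteq> l})"

definition extended_points :: "('k::field \<Rightarrow> 'l::field) \<Rightarrow> ('k ^ 'n) set set \<Rightarrow> ('l ^ 'n) set set" where
  "extended_points \<iota> L = {Q \<in> proj_points. \<exists>l\<in>L. Q \<subseteq> extended_line \<iota> l}"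

end

theory Submission imports Defs begin

text \<open>
  Fix \<open>\<omega>\<close> in the larger field outside the smaller one. Every vector over the larger field is uniquely
  \<open>u + \<omega> v\<close> with \<open>u\<close>, \<open>v\<close> over the smaller one, and it lies on the extended line of \<open>l\<close> if and only if
  \<open>u\<close> and \<open>v\<close> lie in \<open>l\<close>. In particular an imaginary point is on at most one extended line.

  The real points of a hyperplane \<open>H\<close> of the extension form a hyperplane or an \<open>(r - 2)\<close>-space \<open>W\<close>, and every
  \<open>(r - 2)\<close>-space arises in this way. Counting along the extended lines, \<open>H\<close> contains
  \<open>|L| + q\<^sup>2 y - (m - 1) |W|\<close> points, where \<open>y\<close> is the number of lines of \<open>L\<close> in \<open>W\<close> and \<open>|W|\<close> the
  number of points of \<open>W\<close>. If \<open>W\<close> is a hyperplane, \<open>y\<close> is determined by \<open>m\<close>, so that one size \<open>h\<close> always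
  occurs; if \<open>W\<close> is an \<open>(r - 2)\<close>-space, the two values of \<open>y\<close> in the definition of a dual cover correspond to
  the sizes \<open>h\<close> and \<open>h - q\<^sup>r\<^sup>-\<^sup>1\<close>.

  Write \<open>f\<close> for the size as a function of the hyperplane. The first two moments of \<open>f\<close> are those of any
  point set of the given size. They yield \<open>\<Sum> (f - h) (f - h + q\<^sup>r\<^sup>-\<^sup>1) = 0\<close> for every cover, and
  \<open>\<Sum> (f - h) \<noteq> 0\<close> because \<open>m\<close> is less than the number of lines through a point. If \<open>f\<close> takes
  just the values \<open>h\<close> and \<open>c\<close>, then also \<open>\<Sum> (f - h) (f - c) = 0\<close>, and subtracting gives \<open>c = h - q\<^sup>r\<^sup>-\<^sup>1\<close>. Conversely,
  a dual cover has \<open>f\<close> with values in \<open>{h, h - q\<^sup>r\<^sup>-\<^sup>1}\<close>, and \<open>f\<close> is not constantly \<open>h\<close>.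
\<close>

section \<open>Linear algebra over finite fields\<close>

definition dot :: "'k::field ^ 'n \<Rightarrow> 'k ^ 'n \<Rightarrow> 'k" where
  "dot a x = (\<Sum>i\<in>UNIV. a $ i * x $ i)"

lemma dot_add_right: "dot a (x + y) = dot a x + dot a y"
  by (simp add: dot_def algebra_simps sum.distrib)

lemma dot_scale_right: "dot a (c *s x) = c * dot a x"
  by (simp add: dot_def algebra_simps sum_distrib_left)

lemma dot_diff_right: "dot a (x - y) = dot a x - dot a y"
  by (simp add: dot_def algebra_simps sum_subtractf)

lemma dot_zero_right [simp]: "dot a 0 = 0"
  by (simp add: dot_def)

lemma dot_commute: "dot a x = dot x a"
  by (simp add: dot_def mult.commute)

lemma dot_zero_left [simp]: "dot 0 x = 0"
  by (simp add: dot_def)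

lemma dot_axis: "dot a (axis i 1) = a $ i"
proof -
  have "dot a (axis i 1) = (\<Sum>j\<in>UNIV. if j = i then a $ j else 0)"
    unfolding dot_def by (rule sum.cong) (auto simp: axis_def)
  then show ?thesis by simp
qed

lemma subspace_dot_kernel: "vec.subspace S \<Longrightarrow> vec.subspace {x \<in> S. dot a x = 0}"
  by (auto simp: vec.subspace_def dot_add_right dot_scale_right)

section \<open>Counting vectors in subspaces and in kernels\<close>

lemma card_span_independent:
  fixes B :: "('k::{field,finite} ^ 'n) set"
  assumes "vec.independent B"
  shows "card (vec.span B) = CARD('k) ^ card B"
proof -
  have "finite B" by simp
  then show ?thesis using assms
  proof (induction B rule: finite_induct)
    case empty
    then show ?case by simp
  next
    case (insert b B)
    then have ind: "vec.independent B" and b: "b \<notin> vec.span B"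
      by (auto simp: vec.independent_insert)
    \<comment> \<open>Since \<open>b\<close> lies outside \<open>vec.span B\<close>, its coefficient
      and the remainder are unique, so adjoining \<open>b\<close> multiplies the count by the field
      size.\<close>
    have "bij_betw (\<lambda>(k, y). k *s b + y) (UNIV \<times> vec.span B) (vec.span (insert b B))"
      unfolding bij_betw_def
    proof
      show "inj_on (\<lambda>(k, y). k *s b + y) (UNIV \<times> vec.span B)"
      proof (rule inj_onI, clarify)
        fix k k' y y' assume y: "y \<in> vec.span B" "y' \<in> vec.span B" and e: "k *s b + y = k' *s b + y'"
        have "(k - k') *s b = y' - y" using e by (simp add: vec.scale_left_diff_distrib algebra_simps)
        also have "\<dots> \<in> vec.span B" using y by (rule vec.span_diff[rotated])
        finally have m: "(k - k') *s b \<in> vec.span B" .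
        have "k = k'"
        proof (rule ccontr)
          assume "k \<noteq> k'"
          then have "b = inverse (k - k') *s ((k - k') *s b)"
            by (simp add: vector_smult_assoc)
          with m b show False using vec.span_scale by metis
        qed
        then show "k = k' \<and> y = y'" using e by simp
      qed
      show "(\<lambda>(k, y). k *s b + y) ` (UNIV \<times> vec.span B) = vec.span (insert b B)"
      proof (intro equalityI subsetI)
        fix x assume "x \<in> (\<lambda>(k, y). k *s b + y) ` (UNIV \<times> vec.span B)"
        then obtain k y where "x = k *s b + y" "y \<in> vec.span B" by auto
        then have "x - k *s b \<in> vec.span B" by simp
        then show "x \<in> vec.span (insert b B)" unfolding vec.span_breakdown_eq by blast
      next
        fix x assume "x \<in> vec.span (insert b B)"
        then obtain k where "x - k *s b \<in> vec.span B" by (auto simp: vec.span_breakdown_eq)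
        then show "x \<in> (\<lambda>(k, y). k *s b + y) ` (UNIV \<times> vec.span B)"
          by (intro image_eqI[of _ _ "(k, x - k *s b)"]) auto
      qed
    qed
    from bij_betw_same_card[OF this]
    have "card (vec.span (insert b B)) = CARD('k) * card (vec.span B)"
      by (simp add: card_cartesian_product)
    then show ?case using insert ind by simp
  qed
qed

lemma card_subspace:
  fixes S :: "('k::{field,finite} ^ 'n) set"
  assumes "vec.subspace S"
  shows "card S = CARD('k) ^ vec.dim S"
proof -
  obtain B where B: "B \<subseteq> S" "vec.independent B" "S \<subseteq> vec.span B" "card B = vec.dim S"
    using vec.basis_exists by blast
  then have "vec.span B = S" using assms by (simp add: vec.span_subspace)
  then show ?thesis using card_span_independent[OF B(2)] B(4) by simp
qed

lemma two_le_card_field: "2 \<le> CARD('k::{field,finite})"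
proof -
  have "card {0, 1 :: 'k} \<le> CARD('k)" by (rule card_mono) auto
  then show ?thesis by simp
qed

text \<open>Distinct powers of the field size are different numbers, so the size of a subspace fixes
  its dimension. This reduces later comparisons of dimensions to cardinalities.\<close>

lemma mem_n_spaces_iff_card:
  fixes U :: "('k::{field,finite} ^ 'n) set"
  shows "U \<in> n_spaces d \<longleftrightarrow> vec.subspace U \<and> card U = CARD('k) ^ (d + 1)"
proof (cases "vec.subspace U")
  case True
  have "1 < CARD('k)" using two_le_card_field[where 'k='k] by simp
  then show ?thesis
    using True by (simp add: n_spaces_def card_subspace power_inject_exp del: power_Suc)
qed (simp add: n_spaces_def)

text \<open>The functional does not vanish at \<open>v\<close>, so \<open>S\<close> is the direct
  sum of the multiples of \<open>v\<close> and the kernel within \<open>S\<close>.\<close>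

lemma card_dot_kernel:
  fixes S :: "('k::{field,finite} ^ 'n) set"
  assumes S: "vec.subspace S" and v: "v \<in> S" "dot c v \<noteq> 0"
  shows "card S = CARD('k) * card {x \<in> S. dot c x = 0}"
proof -
  let ?K = "{x \<in> S. dot c x = 0}"
  have "bij_betw (\<lambda>(k, y). k *s v + y) (UNIV \<times> ?K) S"
    unfolding bij_betw_def
  proof
    show "inj_on (\<lambda>(k, y). k *s v + y) (UNIV \<times> ?K)"
    proof (rule inj_onI, clarify)
      fix k k' y y' assume y: "dot c y = 0" "dot c y' = 0" and e: "k *s v + y = k' *s v + y'"
      then have "dot c (k *s v + y) = dot c (k' *s v + y')" by simp
      then have "k = k'" using y v by (simp add: dot_add_right dot_scale_right)
      then show "k = k' \<and> y = y'" using e by simp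
    qed
    show "(\<lambda>(k, y). k *s v + y) ` (UNIV \<times> ?K) = S"
    proof (intro equalityI subsetI)
      fix x assume "x \<in> (\<lambda>(k, y). k *s v + y) ` (UNIV \<times> ?K)"
      then show "x \<in> S" using S v by (auto intro!: vec.subspace_add vec.subspace_scale)
    next
      fix x assume x: "x \<in> S"
      let ?k = "dot c x / dot c v"
      have "x - ?k *s v \<in> ?K" using x v S
        by (auto simp: dot_diff_right dot_scale_right intro!: vec.subspace_diff vec.subspace_scale)
      then show "x \<in> (\<lambda>(k, y). k *s v + y) ` (UNIV \<times> ?K)"
        by (intro image_eqI[of _ _ "(?k, x - ?k *s v)"]) auto
    qed
  qed
  from bij_betw_same_card[OF this] show ?thesis by (simp add: card_cartesian_product)
qed

lemma dot_nondegenerate: "a \<noteq> 0 \<Longrightarrow> \<exists>v. dot a v \<noteq> 0"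
  by (metis dot_axis vec_eq_iff zero_index)

lemma card_vec: "CARD('k::finite ^ 'n) = CARD('k) ^ CARD('n)"
  by simp

lemma card_dot_hyperplane:
  fixes a :: "'k::{field,finite} ^ 'n"
  assumes "a \<noteq> 0"
  shows "CARD('k) * card {x. dot a x = 0} = CARD('k) ^ CARD('n)"
proof -
  obtain v where "dot a v \<noteq> 0" using dot_nondegenerate[OF assms] by blast
  then show ?thesis using card_dot_kernel[of UNIV v a] by (simp add: card_vec)
qed

lemma dot_kernel_subset_imp_multiple:
  fixes b c :: "'k::field ^ 'n"
  assumes "b \<noteq> 0" and "\<And>v. dot b v = 0 \<Longrightarrow> dot c v = 0"
  shows "\<exists>k. c = k *s b"
proof -
  obtain i where i: "b $ i \<noteq> 0" using assms(1) by (metis vec_eq_iff zero_index)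
  have "c $ j = (c $ i / b $ i) * b $ j" for j
  proof -
    \<comment> \<open>The test vector is supported on the coordinates \<open>i\<close> and
      \<open>j\<close> and annihilated by \<open>b\<close>; applying \<open>c\<close> to it compares
      two entries of \<open>c\<close>.\<close>
    have "dot b (b $ i *s axis j 1 - b $ j *s axis i 1) = 0"
      by (simp add: dot_diff_right dot_scale_right dot_axis)
    from assms(2)[OF this] have "b $ i * c $ j = b $ j * c $ i"
      by (simp add: dot_diff_right dot_scale_right dot_axis)
    then show ?thesis using i by (simp add: field_simps)
  qed
  then have "c = (c $ i / b $ i) *s b"
    unfolding vec_eq_iff vector_smult_component by blast
  then show ?thesis by blast
qed

text \<open>As \<open>c\<close> is no multiple of \<open>b\<close>, \<open>dot c\<close> is nonzero
  somewhere on the kernel of \<open>b\<close>, and each equation divides the count by the field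
  size. The product form avoids division of natural numbers.\<close>

lemma card_dot_codim_2:
  fixes b c :: "'k::{field,finite} ^ 'n"
  assumes b: "b \<noteq> 0" and c: "\<nexists>k. c = k *s b"
  shows "CARD('k)\<^sup>2 * card {x. dot b x = 0 \<and> dot c x = 0} = CARD('k) ^ CARD('n)"
proof -
  obtain v where v: "dot b v = 0" "dot c v \<noteq> 0"
    using dot_kernel_subset_imp_multiple[OF b] c by blast
  have "vec.subspace {x. dot b x = 0}" using subspace_dot_kernel[of UNIV b] by simp
  from card_dot_kernel[OF this, of v c] v
  have "card {x. dot b x = 0} = CARD('k) * card {x. dot b x = 0 \<and> dot c x = 0}" by simp
  then show ?thesis using card_dot_hyperplane[OF b] by (simp add: power2_eq_square)
qed

section \<open>Equations for subspaces of codimension one and two\<close>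

lemma separating_functional:
  fixes W :: "('k::field ^ 'n) set"
  assumes W: "vec.subspace W" and v: "v \<notin> W"
  obtains b where "\<And>w. w \<in> W \<Longrightarrow> dot b w = 0" and "dot b v \<noteq> 0"
proof -
  obtain B where B: "B \<subseteq> W" "vec.independent B" "W \<subseteq> vec.span B"
    by (rule vec.basis_exists)
  then have sp: "vec.span B = W" using W by (simp add: vec.span_subspace)
  then have "vec.independent (insert v B)" using B v by (simp add: vec.independent_insertI)
  then obtain g :: "'k ^ 'n \<Rightarrow> 'k ^ 'n" where g: "Vector_Spaces.linear (*s) (*s) g"
    and gv: "\<forall>x\<in>insert v B. g x = (if x = v then v else 0)"
    using vec.linear_independent_extend[of "insert v B" "\<lambda>x. if x = v then v else 0"] by blast
  have "v \<noteq> 0" using v W vec.subspace_0 by metis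
  \<comment> \<open>A coordinate at which \<open>v\<close> is nonzero turns the vector-valued map
    \<open>g\<close> into a functional, given by row \<open>i\<close> of its matrix.\<close>
  then obtain i where i: "v $ i \<noteq> 0" by (metis vec_eq_iff zero_index)
  interpret g: Vector_Spaces.linear "(*s)" "(*s)" g by (fact g)
  have d: "dot (matrix g $ i) x = g x $ i" for x
    using matrix_works[OF g, of x, symmetric] by (simp add: dot_def matrix_vector_mult_def)
  have g0: "g x = 0" if "x \<in> W" for x
  proof -
    have "x \<in> vec.span B" using that sp by simp
    moreover have "g y = 0" if "y \<in> B" for y
      using gv that v B(1) by auto
    ultimately show ?thesis using g.eq_0_on_span by blast
  qed
  show ?thesis
    by (rule that[of "matrix g $ i"]) (use d g0 gv i in auto)
qed

lemma hyperplane_eq_dot_kernel: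
  fixes H :: "('k::{field,finite} ^ 'n) set"
  assumes H: "vec.subspace H" "CARD('k) * card H = CARD('k) ^ CARD('n)"
  obtains a where "a \<noteq> 0" "H = {x. dot a x = 0}"
proof -
  have "card H \<noteq> CARD('k) ^ CARD('n)" using H(2) two_le_card_field[where 'k='k] by auto
  then obtain v where "v \<notin> H" by (metis UNIV_eq_I card_vec)
  then obtain a where a: "\<And>w. w \<in> H \<Longrightarrow> dot a w = 0" "dot a v \<noteq> 0"
    using separating_functional[OF H(1)] by metis
  then have a0: "a \<noteq> 0" by auto
  have "H = {x. dot a x = 0}"
  proof (rule card_subset_eq)
    show "H \<subseteq> {x. dot a x = 0}" using a by blast
    show "card H = card {x. dot a x = 0}"
      using card_dot_hyperplane[OF a0] H(2) two_le_card_field[where 'k='k]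
      by (metis mult_cancel1 not_numeral_le_zero)
  qed simp
  then show ?thesis using that a0 by blast
qed

text \<open>A first functional \<open>b\<close> vanishes on \<open>W\<close>, and its kernel is
  larger than \<open>W\<close> by size. A vector \<open>u\<close> in the difference yields a second
  functional \<open>c\<close>; equality then follows by counting.\<close>

lemma codim_2_eq_dot_kernels:
  fixes W :: "('k::{field,finite} ^ 'n) set"
  assumes W: "vec.subspace W" "CARD('k)\<^sup>2 * card W = CARD('k) ^ CARD('n)"
  obtains b c where "b \<noteq> 0" "\<nexists>k. c = k *s b" "W = {x. dot b x = 0 \<and> dot c x = 0}"
proof -
  have q: "2 \<le> CARD('k)" by (rule two_le_card_field)
  then have W0: "card W \<noteq> 0" using W(2) by (auto intro: ccontr)
  have "1 < CARD('k)\<^sup>2" using q by (intro one_less_power) auto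
  then have "card W \<noteq> CARD('k) ^ CARD('n)" using W(2) W0
    by (metis mult_1 mult_cancel2 nat_neq_iff)
  then obtain v where "v \<notin> W" by (metis UNIV_eq_I card_vec)
  then obtain b where b: "\<And>w. w \<in> W \<Longrightarrow> dot b w = 0" "dot b v \<noteq> 0"
    using separating_functional[OF W(1)] by metis
  then have b0: "b \<noteq> 0" by auto
  have "CARD('k) * (CARD('k) * card W) = CARD('k) * card {x. dot b x = 0}"
    using W(2) card_dot_hyperplane[OF b0] by (simp add: power2_eq_square)
  then have "CARD('k) * card W = card {x. dot b x = 0}" using q by simp
  moreover have "1 * card W < CARD('k) * card W"
    by (rule mult_strict_right_mono) (use q W0 in auto)
  ultimately have "card W < card {x. dot b x = 0}" by simp
  then have "\<not> {x. dot b x = 0} \<subseteq> W" by (meson card_mono finite not_less)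
  then obtain u where u: "dot b u = 0" "u \<notin> W" by blast
  obtain c where c: "\<And>w. w \<in> W \<Longrightarrow> dot c w = 0" "dot c u \<noteq> 0"
    using separating_functional[OF W(1) u(2)] by metis
  have nc: "\<nexists>k. c = k *s b"
    using c(2) u(1) by (metis dot_commute dot_scale_right mult_zero_right)
  have "W = {x. dot b x = 0 \<and> dot c x = 0}"
  proof (rule card_subset_eq)
    show "W \<subseteq> {x. dot b x = 0 \<and> dot c x = 0}" using b c by blast
    have "CARD('k)\<^sup>2 * card W = CARD('k)\<^sup>2 * card {x. dot b x = 0 \<and> dot c x = 0}"
      using W(2) card_dot_codim_2[OF b0 nc] by simp
    then show "card W = card {x. dot b x = 0 \<and> dot c x = 0}" using q by simp
  qed simp
  then show ?thesis using that b0 nc by blast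
qed

section \<open>Projective points and their vectors\<close>

lemma n_space_0_eq_span:
  fixes P :: "('k::{field,finite} ^ 'n) set"
  assumes "P \<in> proj_points" "x \<in> P" "x \<noteq> 0"
  shows "P = vec.span {x}"
proof -
  have P: "vec.subspace P" "card P = CARD('k)" using assms(1) by (auto simp: mem_n_spaces_iff_card)
  have "vec.span {x} \<subseteq> P" using P(1) assms(2) by (simp add: vec.span_minimal)
  moreover have "card (vec.span {x}) = CARD('k)"
    using card_span_independent[of "{x}"] assms(3) by simp
  ultimately show ?thesis using P by (metis card_subset_eq finite)
qed

lemma span_singleton_proj_point:
  fixes x :: "'k::{field,finite} ^ 'n"
  assumes "x \<noteq> 0"
  shows "vec.span {x} \<in> proj_points"
  using assms card_span_independent[of "{x}"] by (simp add: mem_n_spaces_iff_card)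

lemma proj_point_eq_span:
  fixes P :: "('k::{field,finite} ^ 'n) set"
  assumes "P \<in> proj_points"
  obtains x where "x \<noteq> 0" "P = vec.span {x}"
proof -
  have "card P = CARD('k)" using assms by (auto simp: mem_n_spaces_iff_card)
  then have "P \<noteq> {0}" using two_le_card_field[where 'k='k] by auto
  moreover have "0 \<in> P" using assms by (auto simp: mem_n_spaces_iff_card vec.subspace_0)
  ultimately obtain x where "x \<in> P" "x \<noteq> 0" by blast
  then show ?thesis using that n_space_0_eq_span assms by blast
qed

lemma span_singleton_subset_iff:
  "vec.subspace U \<Longrightarrow> vec.span {x} \<subseteq> U \<longleftrightarrow> x \<in> U"
  by (meson empty_subsetI insert_subset vec.span_base vec.span_minimal singletonI subsetD)

lemma subspace_scale_mem_iff:
  assumes S: "vec.subspace S" and c: "c \<noteq> 0"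
  shows "c *s x \<in> S \<longleftrightarrow> x \<in> S"
proof
  assume "c *s x \<in> S"
  then have "inverse c *s (c *s x) \<in> S" by (rule vec.subspace_scale[OF S])
  then show "x \<in> S" using c by (simp add: vector_smult_assoc)
qed (rule vec.subspace_scale[OF S])

text \<open>Distinct points share no nonzero vector, so points can be counted through their nonzero
  vectors.\<close>

lemma card_points_in_subspace:
  fixes S :: "('k::{field,finite} ^ 'n) set set"
  assumes S: "S \<subseteq> proj_points" and H: "vec.subspace H"
  shows "card {x \<in> H. x \<noteq> 0 \<and> vec.span {x} \<in> S} = (CARD('k) - 1) * card {P \<in> S. P \<subseteq> H}"
proof -
  have "{x \<in> H. x \<noteq> 0 \<and> vec.span {x} \<in> S} = (\<Union>P\<in>{P \<in> S. P \<subseteq> H}. P - {0})" (is "?X = ?Y")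
  proof (intro equalityI subsetI)
    fix x assume x: "x \<in> ?X"
    then have "vec.span {x} \<subseteq> H" using span_singleton_subset_iff[OF H] by simp
    then show "x \<in> ?Y" using x vec.span_base[of x "{x}"] by auto
  next
    fix x assume "x \<in> ?Y"
    then obtain P where P: "P \<in> S" "P \<subseteq> H" "x \<in> P" "x \<noteq> 0" by auto
    then show "x \<in> ?X" using n_space_0_eq_span[of P x] S by auto
  qed
  also have "card \<dots> = (\<Sum>P\<in>{P \<in> S. P \<subseteq> H}. card (P - {0}))"
  proof (rule card_UN_disjoint)
    show "\<forall>P\<in>{P \<in> S. P \<subseteq> H}. \<forall>Q\<in>{P \<in> S. P \<subseteq> H}. P \<noteq> Q \<longrightarrow> (P - {0}) \<inter> (Q - {0}) = {}"
      using n_space_0_eq_span S by blast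
  qed auto
  also have "\<dots> = (\<Sum>P\<in>{P \<in> S. P \<subseteq> H}. CARD('k) - 1)"
  proof (rule sum.cong)
    fix P assume "P \<in> {P \<in> S. P \<subseteq> H}"
    then have "P \<in> proj_points" using S by blast
    then have "card P = CARD('k)" "0 \<in> P" by (auto simp: mem_n_spaces_iff_card vec.subspace_0)
    then show "card (P - {0}) = CARD('k) - 1" by simp
  qed simp
  finally show ?thesis by simp
qed

section \<open>Double counting and moments\<close>

lemma sum_card_eq_sum_card:
  assumes "finite A" "finite B"
  shows "(\<Sum>a\<in>A. card {b \<in> B. R a b}) = (\<Sum>b\<in>B. card {a \<in> A. R a b})"
  using sum.swap_restrict[OF assms, of "\<lambda>_ _. 1::nat" R] by simp

lemma real_card_eq_sum:
  "finite A \<Longrightarrow> real (card {x \<in> A. P x}) = (\<Sum>x\<in>A. if P x then 1 else 0)"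
  by (simp add: sum.If_cases Int_def)

lemma real_card_Diff_singleton:
  "finite A \<Longrightarrow> a \<in> A \<Longrightarrow> real (card (A - {a})) = real (card A) - 1"
  using card_Suc_Diff1[of A a] by linarith

text \<open>
  Summing over all vectors \<open>a\<close>, and not over the hyperplanes, counts every hyperplane with the
  weight \<open>CARD('k) - 1\<close> and the whole space once; this avoids quotients.
\<close>

lemma sum_card_dot_kernel:
  fixes X :: "('k::{field,finite} ^ 'n) set"
  assumes "0 \<notin> X"
  shows "CARD('k) * (\<Sum>a\<in>UNIV. card {x \<in> X. dot a x = 0}) = card X * CARD('k) ^ CARD('n)"
proof -
  have "(\<Sum>a\<in>UNIV. card {x \<in> X. dot a x = 0}) = (\<Sum>x\<in>X. card {a. dot a x = 0})"
    using sum_card_eq_sum_card[of UNIV X "\<lambda>a x. dot a x = 0"] by simp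
  then have "CARD('k) * (\<Sum>a\<in>UNIV. card {x \<in> X. dot a x = 0})
      = (\<Sum>x\<in>X. CARD('k) * card {a. dot x a = 0})"
    by (simp add: sum_distrib_left dot_commute)
  also have "\<dots> = (\<Sum>x\<in>X. CARD('k) ^ CARD('n))"
    by (rule sum.cong[OF refl], rule card_dot_hyperplane) (use assms in auto)
  finally show ?thesis by simp
qed

text \<open>The square counts ordered pairs of vectors in a kernel. After exchanging the order of
  counting, a pair is either proportional or independent, and closure under scaling fixes the number
  of proportional pairs.\<close>

lemma sum_card_dot_kernel_square:
  fixes X :: "('k::{field,finite} ^ 'n) set"
  assumes X0: "0 \<notin> X" and X: "\<And>c x. c \<noteq> 0 \<Longrightarrow> x \<in> X \<Longrightarrow> c *s x \<in> X"
  shows "(real CARD('k))\<^sup>2 * (\<Sum>a\<in>UNIV. (real (card {x \<in> X. dot a x = 0}))\<^sup>2)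
    = real (card X) * (real (card X) + (real CARD('k) - 1)\<^sup>2) * real CARD('k) ^ CARD('n)"
proof -
  let ?q = "CARD('k)" and ?N = "CARD('k) ^ CARD('n)"
  have inner: "?q\<^sup>2 * (\<Sum>y\<in>X. card {a. dot x a = 0 \<and> dot y a = 0}) = (card X + (?q - 1)\<^sup>2) * ?N"
    if x: "x \<in> X" for x
  proof -
    let ?D = "{y \<in> X. \<exists>k. y = k *s x}"
    have x0: "x \<noteq> 0" using x X0 by auto
    have D: "?D = (\<lambda>k. k *s x) ` (UNIV - {0})"
      using X[OF _ x] X0 by auto
    have "card ?D = card (UNIV - {0 :: 'k})"
      unfolding D by (rule card_image) (use x0 in \<open>auto simp: inj_on_def\<close>)
    then have cD: "card ?D = ?q - 1" by simp
    have "?q\<^sup>2 * (\<Sum>y\<in>X. card {a. dot x a = 0 \<and> dot y a = 0})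
        = (\<Sum>y\<in>X. ?q\<^sup>2 * card {a. dot x a = 0 \<and> dot y a = 0})"
      by (simp add: sum_distrib_left)
    also have "\<dots> = (\<Sum>y\<in>X. if y \<in> ?D then ?q * ?N else ?N)"
    proof (rule sum.cong)
      fix y assume y: "y \<in> X"
      show "?q\<^sup>2 * card {a. dot x a = 0 \<and> dot y a = 0} = (if y \<in> ?D then ?q * ?N else ?N)"
      proof (cases "y \<in> ?D")
        case True
        then obtain k where "y = k *s x" by blast
        then have "{a. dot x a = 0 \<and> dot y a = 0} = {a. dot x a = 0}"
          by (auto simp: dot_commute[of "k *s x"] dot_scale_right dot_commute[of x])
        then show ?thesis using True card_dot_hyperplane[OF x0] by (simp add: power2_eq_square)
      next
        case False
        then show ?thesis using card_dot_codim_2[OF x0, of y] y by auto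
      qed
    qed simp
    also have "\<dots> = card ?D * (?q * ?N) + card (X - ?D) * ?N"
    proof -
      have "X \<inter> {y. y \<in> ?D} = ?D" "X \<inter> - {y. y \<in> ?D} = X - ?D" by auto
      then show ?thesis by (subst sum.If_cases) (simp_all only: finite sum_constant of_nat_id)
    qed
    also have "card (X - ?D) = card X - (?q - 1)"
      using cD by (subst card_Diff_subset) auto
    finally have *: "?q\<^sup>2 * (\<Sum>y\<in>X. card {a. dot x a = 0 \<and> dot y a = 0})
        = (?q - 1) * (?q * ?N) + (card X - (?q - 1)) * ?N" using cD by simp
    \<comment> \<open>The variables \<open>z\<close> and \<open>w\<close> remove the truncated
      subtractions before the algebra.\<close>
    have "?q - 1 \<le> card X" using cD by (metis (no_types, lifting) card_mono finite mem_Collect_eq subsetI)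
    then obtain z where z: "card X = ?q - 1 + z" using le_Suc_ex by blast
    obtain w where w: "?q = Suc w" using two_le_card_field[where 'k='k] by (metis Suc_le_D numeral_2_eq_2)
    show ?thesis unfolding * z using w by (simp add: algebra_simps power2_eq_square)
  qed
  have "(\<Sum>a\<in>UNIV. (card {x \<in> X. dot a x = 0})\<^sup>2)
      = (\<Sum>a\<in>UNIV. card {p \<in> X \<times> X. dot a (fst p) = 0 \<and> dot a (snd p) = 0})"
  proof (rule sum.cong)
    fix a :: "'k ^ 'n"
    have "{p \<in> X \<times> X. dot a (fst p) = 0 \<and> dot a (snd p) = 0}
        = {x \<in> X. dot a x = 0} \<times> {x \<in> X. dot a x = 0}" by auto
    then show "(card {x \<in> X. dot a x = 0})\<^sup>2
        = card {p \<in> X \<times> X. dot a (fst p) = 0 \<and> dot a (snd p) = 0}"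
      by (simp add: card_cartesian_product power2_eq_square)
  qed simp
  also have "\<dots> = (\<Sum>p\<in>X \<times> X. card {a. dot a (fst p) = 0 \<and> dot a (snd p) = 0})"
    using sum_card_eq_sum_card[of UNIV "X \<times> X" "\<lambda>a p. dot a (fst p) = 0 \<and> dot a (snd p) = 0"] by simp
  also have "\<dots> = (\<Sum>x\<in>X. \<Sum>y\<in>X. card {a. dot x a = 0 \<and> dot y a = 0})"
    by (simp add: sum.cartesian_product dot_commute case_prod_beta)
  finally have "?q\<^sup>2 * (\<Sum>a\<in>UNIV. (card {x \<in> X. dot a x = 0})\<^sup>2)
      = (\<Sum>x\<in>X. ?q\<^sup>2 * (\<Sum>y\<in>X. card {a. dot x a = 0 \<and> dot y a = 0}))"
    by (simp add: sum_distrib_left)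
  also have "\<dots> = card X * (card X + (?q - 1)\<^sup>2) * ?N"
    using inner by simp
  finally have "real (?q\<^sup>2 * (\<Sum>a\<in>UNIV. (card {x \<in> X. dot a x = 0})\<^sup>2))
      = real (card X * (card X + (?q - 1)\<^sup>2) * ?N)" by (rule arg_cong)
  then show ?thesis using two_le_card_field[where 'k='k] by (simp add: of_nat_diff)
qed

section \<open>Quadratic extensions\<close>

text \<open>The elements \<open>1\<close> and \<open>\<omega>\<close> serve as a basis of the larger
  field over the image of the smaller one. That they span is derived from the cardinality in
  \<open>extension_decomposition\<close>.\<close>

locale quadratic_extension =
  fixes \<iota> :: "'k::{field,finite} \<Rightarrow> 'l::{field,finite}" and \<omega> :: 'l
  assumes embedding: "field_embedding \<iota>"
    and card_extension: "CARD('l) = CARD('k)\<^sup>2"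
    and omega_not_in_range: "\<omega> \<notin> range \<iota>"
begin

lemma iota_one [simp]: "\<iota> 1 = 1"
  and iota_add: "\<iota> (x + y) = \<iota> x + \<iota> y"
  and iota_mult: "\<iota> (x * y) = \<iota> x * \<iota> y"
  using embedding by (auto simp: field_embedding_def)

lemma iota_zero [simp]: "\<iota> 0 = 0"
  using iota_add[of 0 0] by (simp only: add_0_right add_cancel_right_right)

lemma iota_diff: "\<iota> (x - y) = \<iota> x - \<iota> y"
  using iota_add[of "x - y" y] by (simp add: algebra_simps)

lemma iota_divide: "y \<noteq> 0 \<Longrightarrow> \<iota> (x / y) * \<iota> y = \<iota> x"
  by (simp add: iota_mult[symmetric])

lemma iota_eq_zero_iff [simp]: "\<iota> x = 0 \<longleftrightarrow> x = 0"
  using iota_divide[of x 1] by (metis iota_divide iota_one iota_zero mult_zero_right zero_neq_one)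

lemma iota_inject [simp]: "\<iota> x = \<iota> y \<longleftrightarrow> x = y"
  using iota_eq_zero_iff[of "x - y"] by (simp add: iota_diff)

lemma iota_sum: "\<iota> (\<Sum>i\<in>A. f i) = (\<Sum>i\<in>A. \<iota> (f i))"
  by (induction A rule: infinite_finite_induct) (auto simp: iota_add)

text \<open>If \<open>b\<close> and \<open>b'\<close> differed, \<open>\<omega>\<close> would be a
  quotient of elements of \<open>range \<iota>\<close>.\<close>

lemma iota_omega_inject:
  "\<iota> a + \<omega> * \<iota> b = \<iota> a' + \<omega> * \<iota> b' \<longleftrightarrow> a = a' \<and> b = b'"
proof
  assume "\<iota> a + \<omega> * \<iota> b = \<iota> a' + \<omega> * \<iota> b'"
  then have e: "\<omega> * \<iota> (b - b') = \<iota> (a' - a)" by (simp add: iota_diff algebra_simps)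
  have "b = b'"
  proof (rule ccontr)
    assume "b \<noteq> b'"
    then have b: "b - b' \<noteq> 0" by simp
    then have "\<omega> * \<iota> (b - b') = \<iota> ((a' - a) / (b - b')) * \<iota> (b - b')"
      using e iota_divide by simp
    then have "\<omega> = \<iota> ((a' - a) / (b - b'))" using b by (simp del: iota_inject)
    then show False using omega_not_in_range by blast
  qed
  then show "a = a' \<and> b = b'" using e by simp
qed simp

text \<open>The \<open>CARD('k)\<^sup>2\<close> expressions are pairwise distinct, hence exhaust the
  larger field.\<close>

lemma extension_decomposition:
  obtains a b where "z = \<iota> a + \<omega> * \<iota> b"
proof -
  let ?f = "\<lambda>(a, b). \<iota> a + \<omega> * \<iota> b"
  have "inj ?f" by (auto simp: inj_def iota_omega_inject)
  then have "card (range ?f) = CARD('l)"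
    using card_extension by (simp add: card_image power2_eq_square card_cartesian_product
      flip: UNIV_Times_UNIV)
  then have "range ?f = UNIV" by (simp add: card_subset_eq)
  then have "z \<in> range ?f" by simp
  then show ?thesis using that by auto
qed

section \<open>Coordinates of vectors over the smaller field\<close>

definition extend :: "'k ^ 'n \<Rightarrow> 'l ^ 'n" where
  "extend u = (\<chi> i. \<iota> (u $ i))"

definition combine :: "'k ^ 'n \<Rightarrow> 'k ^ 'n \<Rightarrow> 'l ^ 'n" where
  "combine u v = extend u + \<omega> *s extend v"

lemma extend_nth [simp]: "extend u $ i = \<iota> (u $ i)"
  by (simp add: extend_def)

lemma combine_nth [simp]: "combine u v $ i = \<iota> (u $ i) + \<omega> * \<iota> (v $ i)"
  by (simp add: combine_def)

lemma combine_inject [simp]: "combine u v = combine u' v' \<longleftrightarrow> u = u' \<and> v = v'"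
  by (auto simp: vec_eq_iff iota_omega_inject)

lemma combine_zero_zero [simp]: "combine 0 0 = 0"
  by (simp add: vec_eq_iff)

lemma combine_eq_0_iff [simp]: "combine u v = 0 \<longleftrightarrow> u = 0 \<and> v = 0"
  using combine_inject[of u v 0 0] by simp

lemma extend_eq_combine: "extend u = combine u 0"
  by (simp add: vec_eq_iff)

lemma combine_add: "combine u v + combine u' v' = combine (u + u') (v + v')"
  by (simp add: vec_eq_iff iota_add algebra_simps)

lemma scale_extend: "(\<iota> a + \<omega> * \<iota> b) *s extend u = combine (a *s u) (b *s u)"
  by (simp add: vec_eq_iff iota_mult algebra_simps)

lemma vector_decomposition:
  obtains u v where "x = combine u v"
proof -
  have "\<forall>i. \<exists>a b. x $ i = \<iota> a + \<omega> * \<iota> b" using extension_decomposition by metis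
  then obtain f g where "\<And>i. x $ i = \<iota> (f i) + \<omega> * \<iota> (g i)" by metis
  then have "x = combine (\<chi> i. f i) (\<chi> i. g i)" by (simp add: vec_eq_iff)
  then show ?thesis by (rule that)
qed

text \<open>Multiplication by \<open>z\<close> acts on the two components by a matrix over the
  smaller field, read off from \<open>z\<close> and \<open>z * \<omega>\<close>; its entries do not
  depend on the vectors.\<close>

lemma scale_combine:
  obtains a b c d where "\<And>u v. z *s combine u v = combine (a *s u + c *s v) (b *s u + d *s v)"
proof -
  obtain a b where z: "z = \<iota> a + \<omega> * \<iota> b" by (rule extension_decomposition)
  obtain c d where zo: "z * \<omega> = \<iota> c + \<omega> * \<iota> d" by (rule extension_decomposition)
  have "z *s combine u v = combine (a *s u + c *s v) (b *s u + d *s v)" for u v :: "'k ^ 'n"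
  proof -
    have "z *s combine u v = z *s extend u + (z * \<omega>) *s extend v"
      by (simp add: combine_def vector_add_ldistrib vector_smult_assoc)
    also have "\<dots> = combine (a *s u + c *s v) (b *s u + d *s v)"
      unfolding zo unfolding z scale_extend combine_add ..
    finally show ?thesis .
  qed
  then show ?thesis by (rule that)
qed

lemma subspace_combine:
  assumes "vec.subspace U"
  shows "vec.subspace {combine u v | u v. u \<in> U \<and> v \<in> U}" (is "vec.subspace ?C")
  unfolding vec.subspace_def
proof (intro conjI ballI allI)
  have "0 = combine 0 0" by simp
  then show "0 \<in> ?C" using vec.subspace_0[OF assms] by blast
next
  fix x y assume "x \<in> ?C" "y \<in> ?C"
  then show "x + y \<in> ?C" using vec.subspace_add[OF assms] by (auto simp: combine_add)
next
  fix z x assume "x \<in> ?C"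
  then obtain u v where x: "x = combine u v" "u \<in> U" "v \<in> U" by blast
  obtain a b c d where "z *s combine u v = combine (a *s u + c *s v) (b *s u + d *s v)"
    using scale_combine[of z] by metis
  then show "z *s x \<in> ?C" using x assms by (auto intro!: vec.subspace_add vec.subspace_scale)
qed

lemma span_extend_image:
  assumes "vec.subspace U"
  shows "vec.span (extend ` U) = {combine u v | u v. u \<in> U \<and> v \<in> U}"
proof
  show "vec.span (extend ` U) \<subseteq> {combine u v | u v. u \<in> U \<and> v \<in> U}"
    using subspace_combine[OF assms] vec.subspace_0[OF assms]
    by (intro vec.span_minimal) (auto simp: extend_eq_combine)
  show "{combine u v | u v. u \<in> U \<and> v \<in> U} \<subseteq> vec.span (extend ` U)"
    by (auto simp: combine_def intro!: vec.span_add vec.span_scale intro: vec.span_base)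
qed

lemma combine_mem_span_extend_iff [simp]:
  "vec.subspace U \<Longrightarrow> combine u v \<in> vec.span (extend ` U) \<longleftrightarrow> u \<in> U \<and> v \<in> U"
  by (auto simp: span_extend_image)

lemma extend_mem_span_extend_iff [simp]:
  "vec.subspace U \<Longrightarrow> extend u \<in> vec.span (extend ` U) \<longleftrightarrow> u \<in> U"
  unfolding extend_eq_combine[of u] by (simp add: vec.subspace_0)

lemma card_span_extend:
  assumes "vec.subspace U"
  shows "card (vec.span (extend ` U)) = (card U)\<^sup>2"
proof -
  have "vec.span (extend ` U) = (\<lambda>(u, v). combine u v) ` (U \<times> U)"
    using span_extend_image[OF assms] by auto
  then show ?thesis
    by (simp add: card_image inj_on_def card_cartesian_product power2_eq_square)
qed

lemma span_extend_mem_n_spaces: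
  "U \<in> n_spaces d \<Longrightarrow> vec.span (extend ` U) \<in> n_spaces d"
  by (auto simp: mem_n_spaces_iff_card card_span_extend card_extension power_mult_distrib
      simp flip: power_mult simp: mult.commute)

section \<open>Embedded points and extended lines\<close>

lemma embed_point_eq_span: "embed_point \<iota> P = vec.span (extend ` P)"
  by (simp add: embed_point_def extend_def)

lemma embed_point_span: "embed_point \<iota> (vec.span {u}) = vec.span {extend u}"
proof -
  have "extend (k *s u) = \<iota> k *s extend u" for k by (simp add: vec_eq_iff iota_mult)
  then have "extend ` vec.span {u} \<subseteq> vec.span {extend u}"
    by (auto simp: vec.span_singleton)
  moreover have "extend u \<in> extend ` vec.span {u}" using vec.span_base[of u "{u}"] by blast
  ultimately show ?thesis unfolding embed_point_eq_span
    by (intro antisym vec.span_minimal vec.subspace_span) (auto intro: vec.span_base)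
qed

lemma embed_point_subset_span_extend_iff:
  assumes "P \<in> proj_points" "vec.subspace U"
  shows "embed_point \<iota> P \<subseteq> vec.span (extend ` U) \<longleftrightarrow> P \<subseteq> U"
proof -
  obtain u where "u \<noteq> 0" "P = vec.span {u}" using proj_point_eq_span[OF assms(1)] .
  then show ?thesis
    using assms(2) by (simp add: embed_point_span span_singleton_subset_iff)
qed

text \<open>This resolves the definite description. Any line \<open>g\<close> with the prescribed
  real points contains \<open>extend\<close> applied to each vector of \<open>l\<close>, hence the
  span, and the two have the same size.\<close>

lemma extended_line_eq_span:
  fixes l :: "('k ^ 'n) set"
  assumes l: "l \<in> proj_lines"
  shows "extended_line \<iota> l = vec.span (extend ` l)"
  unfolding extended_line_def
proof (rule the_equality)
  have U: "vec.subspace l" and cl: "card l = CARD('k) ^ 2"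
    using l by (auto simp: mem_n_spaces_iff_card power2_eq_square)
  show "vec.span (extend ` l) \<in> proj_lines \<and>
    {Q \<in> embed_point \<iota> ` proj_points. Q \<subseteq> vec.span (extend ` l)} =
      embed_point \<iota> ` {P \<in> proj_points. P \<subseteq> l}"
    using span_extend_mem_n_spaces[OF l] embed_point_subset_span_extend_iff[OF _ U] by auto
  fix g :: "('l ^ 'n) set"
  assume g: "g \<in> proj_lines \<and>
    {Q \<in> embed_point \<iota> ` proj_points. Q \<subseteq> g} = embed_point \<iota> ` {P \<in> proj_points. P \<subseteq> l}"
  have sg: "vec.subspace g" using g by (auto simp: mem_n_spaces_iff_card)
  have "extend ` l \<subseteq> g"
  proof clarify
    fix u assume u: "u \<in> l"
    show "extend u \<in> g"
    proof (cases "u = 0")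
      case True
      then show ?thesis using vec.subspace_0[OF sg] by (simp add: extend_eq_combine)
    next
      case False
      then have "vec.span {u} \<in> proj_points" "vec.span {u} \<subseteq> l"
        using span_singleton_proj_point U u span_singleton_subset_iff by auto
      then have "embed_point \<iota> (vec.span {u}) \<subseteq> g" using g by blast
      then show ?thesis using sg by (simp add: embed_point_span span_singleton_subset_iff)
    qed
  qed
  then have "vec.span (extend ` l) \<subseteq> g" using sg by (rule vec.span_minimal)
  moreover have "card (vec.span (extend ` l)) = card g"
    using span_extend_mem_n_spaces[OF l] g by (simp add: mem_n_spaces_iff_card)
  ultimately show "g = vec.span (extend ` l)" by (metis card_subset_eq finite)
qed

section \<open>Real points of a hyperplane of the extension\<close>

lemma dot_combine_extend: "dot (combine b c) (extend v) = \<iota> (dot b v) + \<omega> * \<iota> (dot c v)"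
  by (simp add: dot_def iota_sum iota_mult algebra_simps sum.distrib sum_distrib_left)

definition real_part :: "'l ^ 'n \<Rightarrow> ('k ^ 'n) set" where
  "real_part a = {v. dot a (extend v) = 0}"

lemma real_part_combine: "real_part (combine b c) = {v. dot b v = 0 \<and> dot c v = 0}"
  using iota_omega_inject[of _ _ 0 0] by (auto simp: real_part_def dot_combine_extend)

lemma subspace_real_part: "vec.subspace (real_part a)"
proof -
  obtain b c where "a = combine b c" by (rule vector_decomposition)
  then show ?thesis
    by (auto simp: real_part_combine vec.subspace_def dot_add_right dot_scale_right)
qed

text \<open>One equation over the larger field amounts to two over the smaller. These have rank one
  if the components of \<open>a\<close> are proportional and rank two otherwise.\<close>

lemma card_real_part:
  fixes a :: "'l ^ 'n"
  assumes "a \<noteq> 0"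
  obtains "CARD('k) * card (real_part a) = CARD('k) ^ CARD('n)"
    | "CARD('k)\<^sup>2 * card (real_part a) = CARD('k) ^ CARD('n)"
proof -
  obtain b c where a: "a = combine b c" by (rule vector_decomposition)
  consider "b = 0" "c \<noteq> 0" | k where "b \<noteq> 0" "c = k *s b" | "b \<noteq> 0" "\<nexists>k. c = k *s b"
    using assms a by auto
  then show ?thesis
  proof cases
    case 1
    then show ?thesis using that(1) card_dot_hyperplane[of c] by (simp add: a real_part_combine)
  next
    case 2
    then have "real_part a = {v. dot b v = 0}"
      by (auto simp: a real_part_combine dot_commute[of "k *s b"] dot_scale_right dot_commute[of b])
    then show ?thesis using that(1) card_dot_hyperplane[of b] 2 by simp
  next
    case 3
    then show ?thesis using that(2) card_dot_codim_2[of b c] by (simp add: a real_part_combine)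
  qed
qed

text \<open>Coefficients in the smaller field impose a single real equation. This is what makes the
  size \<open>h\<close> occur.\<close>

lemma hyperplane_real_part_exists:
  "\<exists>a :: 'l ^ 'n. a \<noteq> 0 \<and> CARD('k) * card (real_part a) = CARD('k) ^ CARD('n)"
proof -
  obtain i :: 'n where True by blast
  have "axis i 1 \<noteq> (0 :: 'k ^ 'n)" by (simp add: axis_eq_0_iff)
  then show ?thesis
    using card_dot_hyperplane[of "axis i (1::'k)"]
    by (intro exI[of _ "combine (axis i 1) 0"]) (simp add: real_part_combine)
qed

lemma codim_2_eq_real_part:
  fixes W :: "('k ^ 'n) set"
  assumes "vec.subspace W" "CARD('k)\<^sup>2 * card W = CARD('k) ^ CARD('n)"
  obtains a where "a \<noteq> 0" "real_part a = W"
proof -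
  obtain b c where "b \<noteq> 0" "W = {x. dot b x = 0 \<and> dot c x = 0}"
    using codim_2_eq_dot_kernels[OF assms] by metis
  then show ?thesis using that[of "combine b c"] by (simp add: real_part_combine)
qed

text \<open>These are the nonzero vectors on the embedded points of the smaller space.\<close>

definition scaled_real_vectors :: "('l ^ 'n) set" where
  "scaled_real_vectors = {z *s extend v | z v. z \<noteq> 0 \<and> v \<noteq> 0}"

text \<open>The scalar \<open>c\<close> is a quotient of entries of \<open>w\<close> and
  \<open>v\<close>, so it lies in the image of \<open>\<iota>\<close>.\<close>

lemma extend_parallel:
  assumes "v \<noteq> 0" "extend w = c *s extend v"
  obtains k where "c = \<iota> k" "w = k *s v"
proof -
  obtain i where i: "v $ i \<noteq> 0" using assms(1) by (metis vec_eq_iff zero_index)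
  have nth: "\<iota> (w $ j) = c * \<iota> (v $ j)" for j
    using assms(2) by (metis extend_nth vector_smult_component)
  have "c * \<iota> (v $ i) = \<iota> (w $ i / v $ i) * \<iota> (v $ i)" using nth[of i] iota_divide[OF i] by simp
  then have c: "c = \<iota> (w $ i / v $ i)" using i by (simp del: iota_inject)
  have "w $ j = (w $ i / v $ i) * v $ j" for j
    using nth[of j] unfolding c iota_mult[symmetric] by (simp only: iota_inject)
  then have "w = (w $ i / v $ i) *s v" unfolding vec_eq_iff vector_smult_component by blast
  then show ?thesis using that c by blast
qed

text \<open>The pairs \<open>(z, v)\<close> with \<open>z *s extend v\<close> in the kernel are
  counted. A vector arises from \<open>CARD('k) - 1\<close> pairs, because \<open>(z, v)\<close> may
  be replaced exactly by \<open>(z / \<iota> k, k *s v)\<close> with \<open>k\<close>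
  nonzero.\<close>

lemma card_scaled_real_vectors:
  "card {x \<in> scaled_real_vectors. dot a x = 0} = (CARD('k) + 1) * (card (real_part a) - 1)"
proof -
  let ?Z = "(UNIV - {0 :: 'l}) \<times> (real_part a - {0})"
  let ?X = "{x \<in> scaled_real_vectors. dot a x = 0}"
  have q: "2 \<le> CARD('k)" by (rule two_le_card_field)
  have fib: "card {p \<in> ?Z. fst p *s extend (snd p) = x} = CARD('k) - 1" if xX: "x \<in> ?X" for x
  proof -
    obtain z v where x: "x = z *s extend v" "z \<noteq> 0" "v \<noteq> 0" "dot a x = 0"
      using xX unfolding scaled_real_vectors_def by blast
    then have v: "v \<in> real_part a" by (simp add: real_part_def dot_scale_right)
    have "{p \<in> ?Z. fst p *s extend (snd p) = x} = (\<lambda>k. (z / \<iota> k, k *s v)) ` (UNIV - {0})"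
    proof (intro equalityI subsetI)
      fix p assume p: "p \<in> {p \<in> ?Z. fst p *s extend (snd p) = x}"
      obtain y w where [simp]: "p = (y, w)" by (cases p)
      have y: "y \<noteq> 0" "w \<noteq> 0" "y *s extend w = z *s extend v" using p x by auto
      have "extend w = inverse y *s (y *s extend w)" using y(1) by (simp add: vector_smult_assoc)
      also have "\<dots> = (z / y) *s extend v" unfolding y(3) vector_smult_assoc
        by (simp add: field_simps)
      finally obtain k where k: "z / y = \<iota> k" "w = k *s v"
        by (rule extend_parallel[OF x(3)])
      then have "k \<noteq> 0" using y by auto
      moreover have "y = z / \<iota> k" using k(1) x(2) y(1) by (auto simp: field_simps)
      ultimately show "p \<in> (\<lambda>k. (z / \<iota> k, k *s v)) ` (UNIV - {0})" using k by auto
    next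
      fix p assume "p \<in> (\<lambda>k. (z / \<iota> k, k *s v)) ` (UNIV - {0})"
      then obtain k where p: "p = (z / \<iota> k, k *s v)" "k \<noteq> 0" by auto
      have "(z / \<iota> k) *s extend (k *s v) = x"
        using p x by (simp add: vec_eq_iff iota_mult)
      then show "p \<in> {p \<in> ?Z. fst p *s extend (snd p) = x}"
        using p x v vec.subspace_scale[OF subspace_real_part] by auto
    qed
    moreover have "inj_on (\<lambda>k. (z / \<iota> k, k *s v)) (UNIV - {0})"
      using x by (auto simp: inj_on_def)
    ultimately show ?thesis by (simp add: card_image)
  qed
  have "(\<Sum>x\<in>?X. card {p \<in> ?Z. fst p *s extend (snd p) = x})
      = (\<Sum>p\<in>?Z. card {x \<in> ?X. fst p *s extend (snd p) = x})"
    by (rule sum_card_eq_sum_card) auto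
  also have "\<dots> = (\<Sum>p\<in>?Z. 1)"
  proof (rule sum.cong)
    fix p assume "p \<in> ?Z"
    then have p: "fst p \<noteq> 0" "snd p \<noteq> 0" "dot a (extend (snd p)) = 0"
      by (auto simp: real_part_def)
    then have "fst p *s extend (snd p) \<in> scaled_real_vectors"
      unfolding scaled_real_vectors_def by blast
    then have "fst p *s extend (snd p) \<in> ?X" using p by (simp add: dot_scale_right)
    then have "{x \<in> ?X. fst p *s extend (snd p) = x} = {fst p *s extend (snd p)}" by auto
    then show "card {x \<in> ?X. fst p *s extend (snd p) = x} = 1" by simp
  qed simp
  also have "\<dots> = (CARD('k)\<^sup>2 - 1) * (card (real_part a) - 1)"
    using vec.subspace_0[OF subspace_real_part, of a]
    by (simp add: card_cartesian_product card_extension)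
  finally have "card ?X * (CARD('k) - 1) = (CARD('k)\<^sup>2 - 1) * (card (real_part a) - 1)"
    using fib by simp
  moreover have "CARD('k)\<^sup>2 - 1 = (CARD('k) - 1) * (CARD('k) + 1)"
    using q by (cases "CARD('k)") (auto simp: power2_eq_square)
  ultimately have "(CARD('k) - 1) * card ?X
      = (CARD('k) - 1) * ((CARD('k) + 1) * (card (real_part a) - 1))"
    by (metis (no_types, lifting) mult.assoc mult.commute)
  then show ?thesis using q by (simp only: mult_cancel1) auto
qed

end

section \<open>Covers and hyperplanes of the extension\<close>

locale quadratic_extension_cover = quadratic_extension \<iota> \<omega>
  for \<iota> :: "'k::{field,finite} \<Rightarrow> 'l::{field,finite}" and \<omega> :: 'l +
  fixes L :: "('k ^ 'n) set set" and m :: nat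
  assumes lines: "L \<subseteq> proj_lines"
    and m_pos: "0 < m"
    and cover: "P \<in> proj_points \<Longrightarrow> card {l \<in> L. P \<subseteq> l} = m"
begin

section \<open>Incidence counts for a cover\<close>

definition lines_in :: "('k ^ 'n) set \<Rightarrow> nat" where
  "lines_in W = card {l \<in> L. l \<subseteq> W}"

text \<open>The vector \<open>a = 0\<close> is allowed: its kernel is the whole space, so
  \<open>hyperplane_points 0\<close> is the size of the whole set.\<close>

definition hyperplane_points :: "'l ^ 'n \<Rightarrow> nat" where
  "hyperplane_points a = card {P \<in> extended_points \<iota> L. P \<subseteq> {x. dot a x = 0}}"

lemma subspace_line: "l \<in> L \<Longrightarrow> vec.subspace l"
  and card_line: "l \<in> L \<Longrightarrow> card l = CARD('k)\<^sup>2"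
  using lines by (auto simp: mem_n_spaces_iff_card power2_eq_square)

lemma extended_line_of_line: "l \<in> L \<Longrightarrow> extended_line \<iota> l = vec.span (extend ` l)"
  using lines extended_line_eq_span by blast

lemma degree: "v \<noteq> 0 \<Longrightarrow> card {l \<in> L. v \<in> l} = m"
proof -
  assume "v \<noteq> 0"
  then have "card {l \<in> L. vec.span {v} \<subseteq> l} = m"
    by (intro cover span_singleton_proj_point)
  moreover have "{l \<in> L. vec.span {v} \<subseteq> l} = {l \<in> L. v \<in> l}"
    using span_singleton_subset_iff subspace_line by blast
  ultimately show ?thesis by simp
qed

text \<open>Pairs of a nonzero vector of \<open>W\<close> and a cover line through it are counted in
  two ways; the zero vector accounts for both subtractions of one.\<close>

lemma sum_lines_inter_subspace:
  assumes W: "vec.subspace W"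
  shows "(\<Sum>l\<in>L. real (card (l \<inter> W)) - 1) = real m * (real (card W) - 1)"
proof -
  have "(\<Sum>l\<in>L. card {v \<in> W - {0}. v \<in> l}) = (\<Sum>v\<in>W - {0}. card {l \<in> L. v \<in> l})"
    by (rule sum_card_eq_sum_card) auto
  also have "\<dots> = m * card (W - {0})" by (simp add: degree)
  finally have "real (\<Sum>l\<in>L. card {v \<in> W - {0}. v \<in> l}) = real (m * card (W - {0}))"
    by (rule arg_cong)
  moreover have "real (card {v \<in> W - {0}. v \<in> l}) = real (card (l \<inter> W)) - 1" if "l \<in> L" for l
  proof -
    have z: "0 \<in> l \<inter> W" using vec.subspace_0 W subspace_line that by blast
    have "{v \<in> W - {0}. v \<in> l} = l \<inter> W - {0}" by blast
    then show ?thesis using z by (simp only: real_card_Diff_singleton finite)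
  qed
  moreover have "real (card (W - {0})) = real (card W) - 1"
    using vec.subspace_0[OF W] by (simp only: real_card_Diff_singleton finite)
  ultimately show ?thesis by simp
qed

lemma card_lines:
  "real (card L) * ((real CARD('k))\<^sup>2 - 1) = real m * (real CARD('k) ^ CARD('n) - 1)"
proof -
  have "(\<Sum>l\<in>L. real (card (l \<inter> UNIV)) - 1) = (\<Sum>l\<in>L. (real CARD('k))\<^sup>2 - 1)"
    by (rule sum.cong) (auto simp: card_line)
  then show ?thesis using sum_lines_inter_subspace[of UNIV] by (simp add: card_vec)
qed

text \<open>A line lies in a hyperplane or meets it in one point, so the incidence count determines
  how many cover lines the hyperplane contains.\<close>

lemma card_lines_in_hyperplane:
  assumes W: "vec.subspace W" "CARD('k) * card W = CARD('k) ^ CARD('n)"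
  shows "real (card L) * (real CARD('k) - 1) + real (lines_in W) * ((real CARD('k))\<^sup>2 - real CARD('k))
    = real m * (real (card W) - 1)"
proof -
  let ?q = "real CARD('k)"
  have q: "2 \<le> CARD('k)" by (rule two_le_card_field)
  obtain a where a: "W = {x. dot a x = 0}" using hyperplane_eq_dot_kernel[OF W] by metis
  have c: "real (card (l \<inter> W)) - 1 = (?q - 1) + (?q\<^sup>2 - ?q) * (if l \<subseteq> W then 1 else 0)" if l: "l \<in> L" for l
  proof (cases "l \<subseteq> W")
    case True
    then show ?thesis using card_line[OF l] by (simp add: inf_absorb1)
  next
    case False
    then obtain v where "v \<in> l" "dot a v \<noteq> 0" using a by blast
    then have "card l = CARD('k) * card {x \<in> l. dot a x = 0}"
      by (intro card_dot_kernel subspace_line l)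
    moreover have "{x \<in> l. dot a x = 0} = l \<inter> W" using a by blast
    ultimately have "card (l \<inter> W) = CARD('k)"
      using card_line[OF l] q by (simp add: power2_eq_square)
    then show ?thesis using False by simp
  qed
  have "real m * (real (card W) - 1) = (\<Sum>l\<in>L. (?q - 1) + (?q\<^sup>2 - ?q) * (if l \<subseteq> W then 1 else 0))"
    using sum_lines_inter_subspace[OF W(1)] c by simp
  also have "\<dots> = real (card L) * (?q - 1) + (?q\<^sup>2 - ?q) * (\<Sum>l\<in>L. if l \<subseteq> W then 1 else 0)"
    by (simp only: sum.distrib sum_constant sum_distrib_left)
  also have "(\<Sum>l\<in>L. if l \<subseteq> W then 1 else 0) = real (lines_in W)"
    unfolding lines_in_def by (rule real_card_eq_sum[symmetric]) simp
  finally show ?thesis by simp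
qed

text \<open>An extended line is spanned by real vectors, so it lies in the hyperplane exactly when
  \<open>l\<close> lies in the real part. Otherwise it meets the hyperplane in one point.\<close>

lemma card_extended_line_inter_hyperplane:
  assumes l: "l \<in> L"
  shows "real (card {x \<in> vec.span (extend ` l). x \<noteq> 0 \<and> dot a x = 0})
    = (real CARD('l) - 1) * (1 + real CARD('l) * (if l \<subseteq> real_part a then 1 else 0))"
proof -
  let ?K = "{x \<in> vec.span (extend ` l). dot a x = 0}"
  have U: "vec.subspace l" by (rule subspace_line[OF l])
  have card_span: "card (vec.span (extend ` l)) = CARD('l)\<^sup>2"
    using card_span_extend[OF U] card_line[OF l] card_extension by simp
  have card_K: "card ?K = (if l \<subseteq> real_part a then CARD('l)\<^sup>2 else CARD('l))"
  proof (cases "l \<subseteq> real_part a")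
    case True
    have "dot a (combine u v) = 0" if "u \<in> l" "v \<in> l" for u v
    proof -
      have "dot a (extend u) = 0" "dot a (extend v) = 0"
        using True that by (auto simp: real_part_def)
      then show ?thesis by (simp add: combine_def dot_add_right dot_scale_right)
    qed
    then have "?K = vec.span (extend ` l)" unfolding span_extend_image[OF U] by blast
    then show ?thesis using True card_span by simp
  next
    case False
    then obtain u where "u \<in> l" "dot a (extend u) \<noteq> 0" by (auto simp: real_part_def)
    then have "card (vec.span (extend ` l)) = CARD('l) * card ?K"
      by (intro card_dot_kernel[of _ "extend u"]) (auto intro: vec.span_base)
    then have "CARD('l) * card ?K = CARD('l) * CARD('l)"
      using card_span by (simp add: power2_eq_square)
    then show ?thesis using False by (simp only: mult_cancel1) auto
  qed
  have "0 \<in> ?K" by (simp add: vec.span_zero)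
  moreover have "{x \<in> vec.span (extend ` l). x \<noteq> 0 \<and> dot a x = 0} = ?K - {0}" by blast
  ultimately have "real (card {x \<in> vec.span (extend ` l). x \<noteq> 0 \<and> dot a x = 0}) = real (card ?K) - 1"
    by (simp only: real_card_Diff_singleton finite)
  then show ?thesis unfolding card_K by (simp add: algebra_simps power2_eq_square)
qed

lemma line_through_two_vectors_unique:
  assumes "l \<in> L" "l' \<in> L" "u \<in> l" "v \<in> l" "u \<in> l'" "v \<in> l'"
    and u: "u \<noteq> 0" and v: "\<nexists>k. v = k *s u"
  shows "l = l'"
proof -
  have nv: "v \<notin> vec.span {u}" using v by (auto simp: vec.span_singleton)
  have "vec.independent {v, u}"
    using nv u by (intro vec.independent_insertI) (auto simp: vec.independent_empty)
  moreover have "v \<noteq> u" using nv vec.span_base[of u "{u}"] by auto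
  then have "card {v, u} = 2" by simp
  ultimately have c: "card (vec.span {v, u}) = CARD('k)\<^sup>2" using card_span_independent by metis
  have "vec.span {v, u} = k" if "k \<in> L" "u \<in> k" "v \<in> k" for k
  proof -
    have "vec.span {v, u} \<subseteq> k" using that subspace_line by (intro vec.span_minimal) auto
    then show ?thesis using c card_line[OF that(1)] by (metis card_subset_eq finite)
  qed
  then show ?thesis using assms by blast
qed

text \<open>A multiple of a real vector lies on \<open>m\<close> extended lines, and
  \<open>m > 0\<close> makes the first indicator \<open>1\<close>. For any other vector the
  components are independent and determine at most one line.\<close>

lemma card_extended_lines_through:
  assumes x: "x \<noteq> 0"
  shows "real (card {l \<in> L. x \<in> vec.span (extend ` l)})
    = (if \<exists>l\<in>L. x \<in> vec.span (extend ` l) then 1 else 0)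
      + (real m - 1) * (if x \<in> scaled_real_vectors then 1 else 0)"
proof (cases "x \<in> scaled_real_vectors")
  case True
  then obtain z v where zv: "x = z *s extend v" "z \<noteq> 0" "v \<noteq> 0"
    unfolding scaled_real_vectors_def by blast
  have "x \<in> vec.span (extend ` l) \<longleftrightarrow> v \<in> l" if "l \<in> L" for l
    using subspace_line[OF that] zv by (simp add: subspace_scale_mem_iff)
  then have "{l \<in> L. x \<in> vec.span (extend ` l)} = {l \<in> L. v \<in> l}" by blast
  then have c: "card {l \<in> L. x \<in> vec.span (extend ` l)} = m" using degree zv by simp
  then have "{l \<in> L. x \<in> vec.span (extend ` l)} \<noteq> {}" using m_pos by (metis card.empty less_irrefl)
  then show ?thesis using c True by auto
next
  case False
  obtain u v where uv: "x = combine u v" by (rule vector_decomposition)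
  have u0: "u \<noteq> 0"
  proof
    assume "u = 0"
    then have "x = \<omega> *s extend v" using uv by (simp add: vec_eq_iff)
    moreover have "v \<noteq> 0" using \<open>u = 0\<close> uv x by auto
    moreover have "\<omega> \<noteq> 0" using omega_not_in_range iota_zero by (metis rangeI)
    ultimately show False using False unfolding scaled_real_vectors_def by blast
  qed
  \<comment> \<open>If \<open>v\<close> were \<open>k *s u\<close>, then \<open>x\<close> would be
    the multiple of \<open>extend u\<close> by \<open>1 + \<omega> * \<iota> k\<close>, a scaled
    real vector.\<close>
  have nm: "\<nexists>k. v = k *s u"
  proof
    assume "\<exists>k. v = k *s u"
    then obtain k where k: "v = k *s u" ..
    then have "x = (\<iota> 1 + \<omega> * \<iota> k) *s extend u" unfolding scale_extend by (simp add: uv)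
    moreover from this have "\<iota> 1 + \<omega> * \<iota> k \<noteq> 0" using x by auto
    ultimately show False using False u0 unfolding scaled_real_vectors_def by blast
  qed
  show ?thesis
  proof (cases "\<exists>l\<in>L. x \<in> vec.span (extend ` l)")
    case True
    then obtain l where l: "l \<in> L" "x \<in> vec.span (extend ` l)" by blast
    have "l' = l" if "l' \<in> L" "x \<in> vec.span (extend ` l')" for l'
      using that l subspace_line line_through_two_vectors_unique[OF _ _ _ _ _ _ u0 nm] unfolding uv by simp
    then have "{l \<in> L. x \<in> vec.span (extend ` l)} = {l}" using l by blast
    then show ?thesis using True False by simp
  next
    case none: False
    then have "{l \<in> L. x \<in> vec.span (extend ` l)} = {}" by blast
    then show ?thesis using none False by simp
  qed
qed

section \<open>Sizes of hyperplane sections of the extended points\<close>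

lemma extended_points_subset: "extended_points \<iota> L \<subseteq> proj_points"
  by (auto simp: extended_points_def)

lemma span_mem_extended_points_iff:
  "x \<noteq> 0 \<Longrightarrow> vec.span {x} \<in> extended_points \<iota> L \<longleftrightarrow> (\<exists>l\<in>L. x \<in> vec.span (extend ` l))"
  by (auto simp: extended_points_def span_singleton_proj_point extended_line_of_line
      span_singleton_subset_iff)

lemma card_extended_vectors_in_hyperplane:
  "card {x. x \<noteq> 0 \<and> vec.span {x} \<in> extended_points \<iota> L \<and> dot a x = 0}
    = (CARD('l) - 1) * hyperplane_points a"
proof -
  have "vec.subspace {x. dot a x = 0}" using subspace_dot_kernel[of UNIV a] by simp
  from card_points_in_subspace[OF extended_points_subset this]
  show ?thesis unfolding hyperplane_points_def
    by (simp add: conj_commute conj_left_commute)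
qed

lemma real_card_field_minus_1: "real (CARD('l) - 1) = real CARD('l) - 1"
  using two_le_card_field[where 'k='l] by (simp add: of_nat_diff)

text \<open>
  In the sum over the lines of \<open>L\<close> of the points of the extended lines on a hyperplane, every
  imaginary point is counted once and every real point \<open>m\<close> times.
\<close>

lemma hyperplane_points_eq:
  "real (hyperplane_points a) = real (card L) + (real CARD('k))\<^sup>2 * real (lines_in (real_part a))
    - (real m - 1) * ((real (card (real_part a)) - 1) / (real CARD('k) - 1))"
proof -
  let ?q = "real CARD('k)" and ?Q = "real CARD('l)"
  let ?H = "{x. x \<noteq> 0 \<and> dot a x = 0}"
  have q: "2 \<le> CARD('k)" by (rule two_le_card_field)
  have Q: "?Q = ?q\<^sup>2" by (simp add: card_extension)
  have "(\<Sum>l\<in>L. card {x \<in> ?H. x \<in> vec.span (extend ` l)})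
      = (\<Sum>x\<in>?H. card {l \<in> L. x \<in> vec.span (extend ` l)})"
    by (rule sum_card_eq_sum_card) auto
  then have "(\<Sum>l\<in>L. real (card {x \<in> ?H. x \<in> vec.span (extend ` l)}))
      = (\<Sum>x\<in>?H. real (card {l \<in> L. x \<in> vec.span (extend ` l)}))"
    by (simp flip: of_nat_sum)
  also have "\<dots> = (\<Sum>x\<in>?H. (if vec.span {x} \<in> extended_points \<iota> L then 1 else 0)
      + (real m - 1) * (if x \<in> scaled_real_vectors then 1 else 0))"
    by (rule sum.cong) (auto simp: card_extended_lines_through span_mem_extended_points_iff)
  also have "\<dots> = real (card {x \<in> ?H. vec.span {x} \<in> extended_points \<iota> L})
      + (real m - 1) * real (card {x \<in> ?H. x \<in> scaled_real_vectors})"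
    by (simp only: sum.distrib sum_distrib_left[symmetric] real_card_eq_sum[OF finite])
  also have "{x \<in> ?H. vec.span {x} \<in> extended_points \<iota> L}
      = {x. x \<noteq> 0 \<and> vec.span {x} \<in> extended_points \<iota> L \<and> dot a x = 0}" by blast
  also have "{x \<in> ?H. x \<in> scaled_real_vectors} = {x \<in> scaled_real_vectors. dot a x = 0}"
  proof -
    have "extend v \<noteq> 0" if "v \<noteq> 0" for v :: "'k ^ 'n" using that by (simp add: extend_eq_combine)
    then have "0 \<notin> (scaled_real_vectors :: ('l ^ 'n) set)" by (auto simp: scaled_real_vectors_def)
    then show ?thesis by auto
  qed
  finally have lhs: "(\<Sum>l\<in>L. real (card {x \<in> ?H. x \<in> vec.span (extend ` l)}))
      = (?Q - 1) * real (hyperplane_points a)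
        + (real m - 1) * ((?q + 1) * (real (card (real_part a)) - 1))"
  proof -
    \<comment> \<open>The zero vector makes the truncated subtraction exact.\<close>
    have "0 \<in> real_part a" using vec.subspace_0[OF subspace_real_part] .
    then have "card (real_part a) \<noteq> 0" by auto
    then have "real (card (real_part a) - 1) = real (card (real_part a)) - 1" by linarith
    moreover assume "(\<Sum>l\<in>L. real (card {x \<in> ?H. x \<in> vec.span (extend ` l)}))
      = real (card {x. x \<noteq> 0 \<and> vec.span {x} \<in> extended_points \<iota> L \<and> dot a x = 0})
      + (real m - 1) * real (card {x \<in> scaled_real_vectors. dot a x = 0})"
    ultimately show ?thesis
      unfolding card_extended_vectors_in_hyperplane card_scaled_real_vectors of_nat_mult
        real_card_field_minus_1 by simp
  qed
  have "(\<Sum>l\<in>L. real (card {x \<in> ?H. x \<in> vec.span (extend ` l)}))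
      = (\<Sum>l\<in>L. (?Q - 1) * (1 + ?Q * (if l \<subseteq> real_part a then 1 else 0)))"
  proof (rule sum.cong)
    fix l assume "l \<in> L"
    moreover have "{x \<in> ?H. x \<in> vec.span (extend ` l)}
        = {x \<in> vec.span (extend ` l). x \<noteq> 0 \<and> dot a x = 0}" by blast
    ultimately show "real (card {x \<in> ?H. x \<in> vec.span (extend ` l)})
        = (?Q - 1) * (1 + ?Q * (if l \<subseteq> real_part a then 1 else 0))"
      by (simp only: card_extended_line_inter_hyperplane)
  qed simp
  also have "\<dots> = (?Q - 1) * (real (card L) + ?Q * (\<Sum>l\<in>L. if l \<subseteq> real_part a then 1 else 0))"
    by (simp only: sum_distrib_left[symmetric] sum.distrib sum_constant mult_1_right)
  also have "(\<Sum>l\<in>L. if l \<subseteq> real_part a then 1 else 0) = real (lines_in (real_part a))"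
    unfolding lines_in_def by (rule real_card_eq_sum[symmetric]) simp
  finally have "(?q\<^sup>2 - 1) * real (hyperplane_points a)
        + (real m - 1) * ((?q + 1) * (real (card (real_part a)) - 1))
      = (?q\<^sup>2 - 1) * (real (card L) + ?q\<^sup>2 * real (lines_in (real_part a)))"
    unfolding lhs Q .
  moreover have "?q\<^sup>2 - 1 = (?q + 1) * (?q - 1)" by (simp add: algebra_simps power2_eq_square)
  \<comment> \<open>The common factor \<open>?q + 1\<close> splits off, which leaves the real points
    counted by \<open>?q - 1\<close> vectors each.\<close>
  ultimately have "(?q + 1) * ((?q - 1) * real (hyperplane_points a)
        + (real m - 1) * (real (card (real_part a)) - 1))
      = (?q + 1) * ((?q - 1) * (real (card L) + ?q\<^sup>2 * real (lines_in (real_part a))))"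
    by (simp only: distrib_left mult.assoc mult.left_commute)
  then have "(?q - 1) * real (hyperplane_points a) + (real m - 1) * (real (card (real_part a)) - 1)
      = (?q - 1) * (real (card L) + ?q\<^sup>2 * real (lines_in (real_part a)))"
    by (simp only: mult_cancel_left) linarith
  then show ?thesis using q by (simp add: field_simps)
qed

text \<open>These are the vector moments for the nonzero vectors on extended points, with the
  factors \<open>CARD('l) - 1\<close> and its square cancelled. The sums include the term
  \<open>a = 0\<close>.\<close>

lemma sum_hyperplane_points:
  "real CARD('l) * (\<Sum>a\<in>UNIV. real (hyperplane_points a))
    = real (hyperplane_points 0) * real CARD('l) ^ CARD('n)" (is ?thesis1)
  and sum_hyperplane_points_square:
  "(real CARD('l))\<^sup>2 * (\<Sum>a\<in>UNIV. (real (hyperplane_points a))\<^sup>2)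
    = real (hyperplane_points 0) * (real (hyperplane_points 0) + real CARD('l) - 1)
      * real CARD('l) ^ CARD('n)" (is ?thesis2)
proof -
  let ?X = "{x. x \<noteq> 0 \<and> vec.span {x} \<in> extended_points \<iota> L}" and ?Q = "real CARD('l)"
  let ?h = "\<lambda>a. real (hyperplane_points a)" and ?N = "real CARD('l) ^ CARD('n)"
  have Q: "?Q - 1 \<noteq> 0" using two_le_card_field[where 'k='l] by simp
  have X: "real (card {x \<in> ?X. dot a x = 0}) = (?Q - 1) * ?h a" for a
    using card_extended_vectors_in_hyperplane[of a]
    by (simp add: real_card_field_minus_1 conj_assoc)
  from X[of 0] have X0: "real (card ?X) = (?Q - 1) * ?h 0" by simp
  have closed: "c *s x \<in> ?X" if c: "c \<noteq> 0" and x: "x \<in> ?X" for c x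
  proof -
    have "x \<in> vec.span (extend ` l) \<Longrightarrow> c *s x \<in> vec.span (extend ` l)" for l :: "('k ^ 'n) set"
      by (rule vec.span_scale)
    then show ?thesis using c x span_mem_extended_points_iff[of x] span_mem_extended_points_iff[of "c *s x"]
      by auto
  qed
  have "real (CARD('l) * (\<Sum>a\<in>UNIV. card {x \<in> ?X. dot a x = 0})) = real (card ?X * CARD('l) ^ CARD('n))"
    by (rule arg_cong[OF sum_card_dot_kernel]) simp
  then have "?Q * (\<Sum>a\<in>UNIV. (?Q - 1) * ?h a) = (?Q - 1) * ?h 0 * ?N"
    by (simp only: of_nat_mult of_nat_sum X X0 of_nat_power)
  then have "(?Q - 1) * (?Q * (\<Sum>a\<in>UNIV. ?h a)) = (?Q - 1) * (?h 0 * ?N)"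
    by (simp only: sum_distrib_left[symmetric] mult.assoc mult.left_commute)
  then show ?thesis1 using Q by (simp only: mult_cancel_left) auto
  have "?Q\<^sup>2 * (\<Sum>a\<in>UNIV. ((?Q - 1) * ?h a)\<^sup>2)
      = (?Q - 1) * ?h 0 * ((?Q - 1) * ?h 0 + (?Q - 1)\<^sup>2) * ?N"
    using sum_card_dot_kernel_square[OF _ closed] by (simp only: X X0) simp
  then have "(?Q - 1)\<^sup>2 * (?Q\<^sup>2 * (\<Sum>a\<in>UNIV. (?h a)\<^sup>2)) = (?Q - 1)\<^sup>2 * (?h 0 * (?h 0 + ?Q - 1) * ?N)"
    by (simp only: power_mult_distrib sum_distrib_left[symmetric])
      (simp add: algebra_simps power2_eq_square)
  then show ?thesis2 using Q by (simp only: mult_cancel_left) auto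
qed

end

section \<open>From hyperplanes to coefficient vectors\<close>

context quadratic_extension_cover
begin

text \<open>Proportional coefficient vectors repeat a hyperplane, which does not affect an
  image.\<close>

lemma hyperplane_points_image:
  assumes n: "CARD('n) = r + 1" and r: "3 \<le> r"
  shows "(\<lambda>H. card {P \<in> extended_points \<iota> L. P \<subseteq> H}) ` n_spaces (r - 1)
    = hyperplane_points ` (UNIV - {0})"
proof -
  have Q: "2 \<le> CARD('l)" by (rule two_le_card_field)
  have "n_spaces (r - 1) = (\<lambda>a :: 'l ^ 'n. {x. dot a x = 0}) ` (UNIV - {0})"
  proof (intro equalityI subsetI)
    fix H :: "('l ^ 'n) set" assume "H \<in> n_spaces (r - 1)"
    then have "vec.subspace H" "CARD('l) * card H = CARD('l) ^ CARD('n)"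
      using r by (auto simp: mem_n_spaces_iff_card n)
    then obtain a where "a \<noteq> 0" "H = {x. dot a x = 0}" by (rule hyperplane_eq_dot_kernel)
    then show "H \<in> (\<lambda>a. {x. dot a x = 0}) ` (UNIV - {0})" by blast
  next
    fix H :: "('l ^ 'n) set" assume "H \<in> (\<lambda>a. {x. dot a x = 0}) ` (UNIV - {0})"
    then obtain a where a: "a \<noteq> 0" "H = {x. dot a x = 0}" by blast
    have "CARD('l) * card H = CARD('l) * CARD('l) ^ r"
      using card_dot_hyperplane[OF a(1)] by (simp add: a(2) n)
    then have "card H = CARD('l) ^ r" using Q by simp
    moreover have "vec.subspace H" using subspace_dot_kernel[of UNIV a] by (simp add: a(2))
    ultimately show "H \<in> n_spaces (r - 1)" using r by (simp add: mem_n_spaces_iff_card)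
  qed
  then show ?thesis by (auto simp: image_image hyperplane_points_def)
qed

end

text \<open>
  With \<open>k = q\<close>, \<open>p = q\<^sup>r\<^sup>-\<^sup>3\<close> and \<open>w = m / (q + 1)\<close> all numbers below become polynomials in three
  independent variables, up to factors \<open>k - 1\<close>.
\<close>

locale quadratic_extension_cover_params = quadratic_extension_cover \<iota> \<omega> L m
  for \<iota> :: "'k::{field,finite} \<Rightarrow> 'l::{field,finite}" and \<omega> :: 'l
    and L :: "('k ^ 'n) set set" and m :: nat +
  fixes s :: nat and k p w :: real
  assumes dim: "CARD('n) = s + 4"
    and card_k: "real CARD('k) = k"
    and p_eq: "k ^ s = p"
    and m_eq: "real m = w * (k + 1)"
begin

text \<open>This is the size \<open>h\<close> that always occurs, written in the three
  parameters.\<close>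

definition real_hyperplane_size :: real where
  "real_hyperplane_size = ((p * k ^ 3 - 1) + k * (k - 1) * (p * k ^ 2 - 1) * w) / (k - 1)"

lemma k_bounds: "k \<noteq> 0" "k - 1 \<noteq> 0" "k + 1 \<noteq> 0" "1 < k"
  using two_le_card_field[where 'k='k] card_k by auto

lemma p_nonzero: "p \<noteq> 0"
  using p_eq k_bounds(1) by auto

lemma card_lines_scaled:
  "real (card L) * (k - 1) = w * (p * k ^ 4 - 1)"
proof -
  have "real (card L) * (k\<^sup>2 - 1) = (w * (k + 1)) * (p * k ^ 4 - 1)"
    using card_lines unfolding dim power_add card_k p_eq m_eq .
  moreover have "(k + 1) * (real (card L) * (k - 1)) = real (card L) * (k\<^sup>2 - 1)"
    by (simp add: algebra_simps power2_eq_square)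
  ultimately have "(k + 1) * (real (card L) * (k - 1)) = (k + 1) * (w * (p * k ^ 4 - 1))"
    by (simp only: mult.commute mult.left_commute)
  then show ?thesis using k_bounds(3) by (simp only: mult_cancel_left) auto
qed

lemma hyperplane_points_scaled:
  "(k - 1) * real (hyperplane_points a) = w * (p * k ^ 4 - 1)
    + k\<^sup>2 * ((k - 1) * real (lines_in (real_part a)))
    - (w * (k + 1) - 1) * (real (card (real_part a)) - 1)"
proof -
  have "(k - 1) * real (hyperplane_points a) = real (card L) * (k - 1)
    + k\<^sup>2 * ((k - 1) * real (lines_in (real_part a)))
    - (real m - 1) * (real (card (real_part a)) - 1)"
    unfolding hyperplane_points_eq card_k using k_bounds(2) by (simp add: field_simps)
  then show ?thesis unfolding card_lines_scaled m_eq .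
qed

lemma extended_points_scaled:
  "(k - 1) * real (hyperplane_points 0) = (p * k ^ 4 - 1) * (1 + k * (k - 1) * w)"
proof -
  have W: "real_part (0 :: 'l ^ 'n) = UNIV" by (simp add: real_part_def)
  then have "lines_in (real_part (0 :: 'l ^ 'n)) = card L" by (simp add: lines_in_def)
  then have l: "(k - 1) * real (lines_in (real_part (0 :: 'l ^ 'n))) = w * (p * k ^ 4 - 1)"
    using card_lines_scaled by (simp only: mult.commute)
  have c: "real (card (real_part (0 :: 'l ^ 'n))) = p * k ^ 4"
    unfolding W card_vec dim by (simp only: of_nat_power of_nat_mult power_add card_k p_eq)
  show ?thesis unfolding hyperplane_points_scaled l c by algebra
qed

text \<open>The number of cover lines in the real part is fixed by
  \<open>card_lines_in_hyperplane\<close>, and with it the size.\<close>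

lemma hyperplane_points_of_hyperplane:
  assumes W: "CARD('k) * card (real_part a) = CARD('k) ^ CARD('n)"
  shows "real (hyperplane_points a) = real_hyperplane_size"
proof -
  have "k * real (card (real_part a)) = real (CARD('k) * card (real_part a))"
    by (simp only: of_nat_mult card_k)
  also have "\<dots> = p * k ^ 4" unfolding W dim by (simp only: of_nat_power of_nat_mult power_add card_k p_eq)
  also have "\<dots> = k * (p * k ^ 3)" by (simp add: eval_nat_numeral)
  finally have "k * real (card (real_part a)) = k * (p * k ^ 3)" .
  then have c: "real (card (real_part a)) = p * k ^ 3"
    using k_bounds(1) by (simp only: mult_cancel_left) auto
  have "w * (p * k ^ 4 - 1) + real (lines_in (real_part a)) * (k\<^sup>2 - k)
      = w * (k + 1) * (p * k ^ 3 - 1)"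
    using card_lines_in_hyperplane[OF subspace_real_part W]
    unfolding card_lines_scaled c card_k m_eq .
  \<comment> \<open>This identity, valid for all \<open>y\<close>, isolates a bracket that vanishes
    by the preceding equation.\<close>
  moreover have "k * ((k - 1) * y) = k * (w * (p * k ^ 2 - 1)) +
      (w * (p * k ^ 4 - 1) + y * (k\<^sup>2 - k) - w * (k + 1) * (p * k ^ 3 - 1))" for y
    by (simp add: algebra_simps eval_nat_numeral)
  ultimately have "k * ((k - 1) * real (lines_in (real_part a))) = k * (w * (p * k ^ 2 - 1))"
    by (simp only: diff_self add_0_right)
  then have l: "(k - 1) * real (lines_in (real_part a)) = w * (p * k ^ 2 - 1)"
    using k_bounds(1) by (simp only: mult_cancel_left) auto
  have "(k - 1) * real (hyperplane_points a)
      = (p * k ^ 3 - 1) + k * (k - 1) * (p * k ^ 2 - 1) * w"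
    unfolding hyperplane_points_scaled l c by algebra
  then show ?thesis unfolding real_hyperplane_size_def using k_bounds(2) by (simp add: field_simps)
qed

text \<open>The subtracted number is the larger value allowed in a dual cover. The smaller value is
  less by \<open>p\<close> and lowers the size by \<open>p * k\<^sup>2\<close>, that is by
  \<open>q\<^sup>r\<^sup>-\<^sup>1\<close>.\<close>

lemma hyperplane_points_of_codim_2:
  assumes W: "CARD('k)\<^sup>2 * card (real_part a) = CARD('k) ^ CARD('n)"
  shows "real (hyperplane_points a) = real_hyperplane_size
    + k\<^sup>2 * (real (lines_in (real_part a)) - (w * ((p - 1) / (k - 1)) + p))"
proof -
  have "k\<^sup>2 * real (card (real_part a)) = real (CARD('k)\<^sup>2 * card (real_part a))"
    by (simp only: of_nat_mult of_nat_power card_k)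
  also have "\<dots> = p * k ^ 4" unfolding W dim by (simp only: of_nat_power of_nat_mult power_add card_k p_eq)
  also have "\<dots> = k\<^sup>2 * (p * k ^ 2)" by (simp add: eval_nat_numeral)
  finally have "k\<^sup>2 * real (card (real_part a)) = k\<^sup>2 * (p * k ^ 2)" .
  then have c: "real (card (real_part a)) = p * k ^ 2"
    using k_bounds(1) by (simp only: mult_cancel_left) auto
  \<comment> \<open>\<open>t\<close> is the theta number of index \<open>r - 4\<close>; it and
    \<open>B\<close> enter the algebra only after multiplication by \<open>k - 1\<close>.\<close>
  define t where "t = (p - 1) / (k - 1)"
  define B where "B = real_hyperplane_size"
  have t: "(k - 1) * t = p - 1" unfolding t_def using k_bounds(2) by simp
  have B: "(k - 1) * B = (p * k ^ 3 - 1) + k * (k - 1) * (p * k ^ 2 - 1) * w"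
    unfolding B_def real_hyperplane_size_def using k_bounds(2) by simp
  have "(k - 1) * (B + k\<^sup>2 * (real (lines_in (real_part a)) - (w * t + p)))
      = (k - 1) * B + k\<^sup>2 * ((k - 1) * real (lines_in (real_part a)))
        - k\<^sup>2 * w * ((k - 1) * t) - k\<^sup>2 * (k - 1) * p"
    by (simp add: algebra_simps)
  also have "\<dots> = (k - 1) * real (hyperplane_points a)"
    unfolding B t hyperplane_points_scaled c by (simp add: algebra_simps eval_nat_numeral)
  finally have "(k - 1) * real (hyperplane_points a)
      = (k - 1) * (B + k\<^sup>2 * (real (lines_in (real_part a)) - (w * t + p)))" ..
  then show ?thesis using k_bounds(2) unfolding t_def B_def by (simp only: mult_cancel_left) auto
qed

section \<open>Evaluation of the moments\<close>

lemma moments: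
  shows "(\<Sum>a\<in>UNIV. real (hyperplane_points a)) = real (hyperplane_points 0) * (p\<^sup>2 * k ^ 6)"
    and "(\<Sum>a\<in>UNIV. (real (hyperplane_points a))\<^sup>2)
      = real (hyperplane_points 0) * (real (hyperplane_points 0) + k\<^sup>2 - 1) * (p\<^sup>2 * k ^ 4)"
proof -
  have Q: "real CARD('l) = k\<^sup>2" by (simp add: card_extension card_k)
  have Qn: "real CARD('l) ^ CARD('n) = p\<^sup>2 * k ^ 8"
    unfolding Q dim p_eq[symmetric] by (simp add: power_add mult.commute flip: power_mult)
  have "k\<^sup>2 * (\<Sum>a\<in>UNIV. real (hyperplane_points a))
      = real (hyperplane_points 0) * (p\<^sup>2 * k ^ 8)"
    using sum_hyperplane_points unfolding Qn unfolding Q .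
  also have "\<dots> = k\<^sup>2 * (real (hyperplane_points 0) * (p\<^sup>2 * k ^ 6))"
    by (simp add: eval_nat_numeral)
  finally show "(\<Sum>a\<in>UNIV. real (hyperplane_points a)) = real (hyperplane_points 0) * (p\<^sup>2 * k ^ 6)"
    using k_bounds(1) by (simp only: mult_cancel_left) auto
  have "(k\<^sup>2)\<^sup>2 * (\<Sum>a\<in>UNIV. (real (hyperplane_points a))\<^sup>2)
      = real (hyperplane_points 0) * (real (hyperplane_points 0) + k\<^sup>2 - 1) * (p\<^sup>2 * k ^ 8)"
    using sum_hyperplane_points_square unfolding Qn unfolding Q .
  also have "\<dots> = (k\<^sup>2)\<^sup>2 * (real (hyperplane_points 0)
      * (real (hyperplane_points 0) + k\<^sup>2 - 1) * (p\<^sup>2 * k ^ 4))"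
    by (simp add: eval_nat_numeral)
  finally show "(\<Sum>a\<in>UNIV. (real (hyperplane_points a))\<^sup>2)
      = real (hyperplane_points 0) * (real (hyperplane_points 0) + k\<^sup>2 - 1) * (p\<^sup>2 * k ^ 4)"
    using k_bounds(1) by (simp only: mult_cancel_left) auto
qed

lemma card_nonzero_vectors:
  "real (card (UNIV - {0 :: 'l ^ 'n})) = p\<^sup>2 * k ^ 8 - 1"
proof -
  have "real CARD('l ^ 'n) = (k\<^sup>2) ^ (s + 4)"
    unfolding card_vec dim card_extension by (simp add: card_k)
  also have "\<dots> = p\<^sup>2 * k ^ 8"
    unfolding p_eq[symmetric] by (simp add: power_add mult.commute flip: power_mult)
  finally show ?thesis by (simp only: real_card_Diff_singleton finite UNIV_I)
qed

text \<open>The sum factors completely. Its last factor is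
  \<open>m * (k - 1) - (p * k ^ 3 - 1)\<close>, which is negative by the bound on
  \<open>m\<close>.\<close>

lemma sum_deviation_nonzero:
  assumes m: "real m * (k - 1) < p * k ^ 3 - 1"
  shows "(\<Sum>a\<in>UNIV - {0}. real (hyperplane_points a) - real_hyperplane_size) \<noteq> 0"
proof -
  define N B where "N = real (hyperplane_points 0)" and "B = real_hyperplane_size"
  have N: "(k - 1) * N = (p * k ^ 4 - 1) * (1 + k * (k - 1) * w)"
    unfolding N_def by (rule extended_points_scaled)
  have B: "(k - 1) * B = (p * k ^ 3 - 1) + k * (k - 1) * (p * k ^ 2 - 1) * w"
    unfolding B_def real_hyperplane_size_def using k_bounds(2) by simp
  have "(\<Sum>a\<in>UNIV - {0}. real (hyperplane_points a) - B)
      = (\<Sum>a\<in>UNIV - {0}. real (hyperplane_points a)) - (p\<^sup>2 * k ^ 8 - 1) * B"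
    by (simp only: sum_subtractf sum_constant card_nonzero_vectors)
  also have "(\<Sum>a\<in>UNIV - {0}. real (hyperplane_points a)) = N * (p\<^sup>2 * k ^ 6) - N"
    by (simp add: sum_diff1 moments(1) N_def)
  finally have "(\<Sum>a\<in>UNIV - {0}. real (hyperplane_points a) - B)
      = N * (p\<^sup>2 * k ^ 6) - N - (p\<^sup>2 * k ^ 8 - 1) * B" .
  then have "(k - 1) * (\<Sum>a\<in>UNIV - {0}. real (hyperplane_points a) - B)
      = ((k - 1) * N) * (p\<^sup>2 * k ^ 6 - 1) - (p\<^sup>2 * k ^ 8 - 1) * ((k - 1) * B)"
    by (simp only:) (simp add: algebra_simps)
  also have "\<dots> = (k - 1) * ((p * k ^ 4 - 1) * (p * k ^ 3) * (w * (k + 1) * (k - 1) - (p * k ^ 3 - 1)))"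
    unfolding N B by algebra
  finally have "(k - 1) * (\<Sum>a\<in>UNIV - {0}. real (hyperplane_points a) - B) = \<dots>" .
  moreover have "p * k ^ 4 \<noteq> 1"
  proof -
    have "1 < k ^ (s + 4)" using k_bounds(4) by (intro one_less_power) auto
    then show ?thesis by (simp add: power_add p_eq)
  qed
  moreover have "w * (k + 1) * (k - 1) - (p * k ^ 3 - 1) \<noteq> 0"
    using m unfolding m_eq by simp
  ultimately show ?thesis using k_bounds p_nonzero unfolding B_def by auto
qed

text \<open>After expansion only the two moments and the number of nonzero vectors enter, and all
  are functions of \<open>k\<close>, \<open>p\<close> and \<open>w\<close>. The claim becomes a
  polynomial identity.\<close>

lemma sum_deviation_product:
  "(\<Sum>a\<in>UNIV - {0}. (real (hyperplane_points a) - real_hyperplane_size)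
    * (real (hyperplane_points a) - (real_hyperplane_size - p * k\<^sup>2))) = 0"
proof -
  define N B where "N = real (hyperplane_points 0)" and "B = real_hyperplane_size"
  have N: "(k - 1) * N = (p * k ^ 4 - 1) * (1 + k * (k - 1) * w)"
    unfolding N_def by (rule extended_points_scaled)
  have B: "(k - 1) * B = (p * k ^ 3 - 1) + k * (k - 1) * (p * k ^ 2 - 1) * w"
    unfolding B_def real_hyperplane_size_def using k_bounds(2) by simp
  let ?h = "\<lambda>a. real (hyperplane_points a)" and ?c = "B - p * k\<^sup>2"
  have "(\<Sum>a\<in>UNIV - {0}. (?h a - B) * (?h a - ?c))
      = (\<Sum>a\<in>UNIV - {0}. (?h a)\<^sup>2 - (B + ?c) * ?h a + B * ?c)"
    by (rule sum.cong) (auto simp: algebra_simps power2_eq_square)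
  also have "\<dots> = (\<Sum>a\<in>UNIV - {0}. (?h a)\<^sup>2) - (B + ?c) * (\<Sum>a\<in>UNIV - {0}. ?h a)
      + (p\<^sup>2 * k ^ 8 - 1) * (B * ?c)"
    by (simp only: sum_subtractf sum.distrib sum_constant sum_distrib_left[symmetric]
        card_nonzero_vectors)
  also have "(\<Sum>a\<in>UNIV - {0}. ?h a) = N * (p\<^sup>2 * k ^ 6) - N"
    by (simp add: sum_diff1 moments(1) N_def)
  also have "(\<Sum>a\<in>UNIV - {0}. (?h a)\<^sup>2) = N * (N + k\<^sup>2 - 1) * (p\<^sup>2 * k ^ 4) - N\<^sup>2"
    by (simp add: sum_diff1 moments(2) N_def)
  finally have e: "(\<Sum>a\<in>UNIV - {0}. (?h a - B) * (?h a - ?c))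
      = N * (N + k\<^sup>2 - 1) * (p\<^sup>2 * k ^ 4) - N\<^sup>2 - (B + ?c) * (N * (p\<^sup>2 * k ^ 6) - N)
      + (p\<^sup>2 * k ^ 8 - 1) * (B * ?c)" .
  \<comment> \<open>Multiplying by \<open>(k - 1)\<^sup>2\<close> clears the denominators, since
    \<open>A'\<close> and \<open>B'\<close> are polynomials.\<close>
  define A' B' where "A' = (k - 1) * N" and "B' = (k - 1) * B"
  have "(k - 1)\<^sup>2 * (\<Sum>a\<in>UNIV - {0}. (?h a - B) * (?h a - ?c))
      = A' * (A' + (k - 1) * (k\<^sup>2 - 1)) * (p\<^sup>2 * k ^ 4) - A'\<^sup>2
        - (2 * B' - (k - 1) * (p * k\<^sup>2)) * (A' * (p\<^sup>2 * k ^ 6) - A')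
        + (p\<^sup>2 * k ^ 8 - 1) * (B' * (B' - (k - 1) * (p * k\<^sup>2)))"
    unfolding e A'_def B'_def by algebra
  also have "\<dots> = 0"
    unfolding A'_def B'_def N B by algebra
  finally show ?thesis using k_bounds(2) unfolding B_def by simp
qed

lemma two_intersection_numbers_iff:
  assumes m: "real m * (k - 1) < p * k ^ 3 - 1"
  shows "card (hyperplane_points ` (UNIV - {0})) = 2 \<longleftrightarrow>
    (\<forall>W. vec.subspace W \<and> CARD('k)\<^sup>2 * card W = CARD('k) ^ CARD('n) \<longrightarrow>
      real (lines_in W) = w * ((p - 1) / (k - 1)) + p \<or>
      real (lines_in W) = w * ((p - 1) / (k - 1)))" (is "?two \<longleftrightarrow> ?dual")
proof -
  define B y where "B = real_hyperplane_size" and "y = w * ((p - 1) / (k - 1))"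
  let ?h = "\<lambda>a. real (hyperplane_points a)" and ?c = "B - p * k\<^sup>2"
  define T where "T = ?h ` (UNIV - {0})"
  have "T = real ` hyperplane_points ` (UNIV - {0})" by (simp add: T_def image_image)
  then have card_T: "card T = card (hyperplane_points ` (UNIV - {0}))" by (simp add: card_image)
  have h2: "?h a = B + k\<^sup>2 * (real (lines_in (real_part a)) - (y + p))"
    if "CARD('k)\<^sup>2 * card (real_part a) = CARD('k) ^ CARD('n)" for a
    using hyperplane_points_of_codim_2[OF that] by (simp add: B_def y_def)
  have h2B: "?h a = B \<longleftrightarrow> real (lines_in (real_part a)) = y + p"
    and h2c: "?h a = ?c \<longleftrightarrow> real (lines_in (real_part a)) = y"
    if "CARD('k)\<^sup>2 * card (real_part a) = CARD('k) ^ CARD('n)" for a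
  proof -
    have "?h a = ?c \<longleftrightarrow> k\<^sup>2 * real (lines_in (real_part a)) = k\<^sup>2 * y"
      unfolding h2[OF that] by (auto simp: algebra_simps)
    then show "?h a = ?c \<longleftrightarrow> real (lines_in (real_part a)) = y" using k_bounds(1) by simp
  qed (use h2[OF that] k_bounds(1) in simp)
  have B_mem: "B \<in> T"
  proof -
    obtain a :: "'l ^ 'n" where a: "a \<noteq> 0" "CARD('k) * card (real_part a) = CARD('k) ^ CARD('n)"
      using hyperplane_real_part_exists by blast
    then have "?h a = B" unfolding B_def by (intro hyperplane_points_of_hyperplane)
    then show ?thesis using a(1) by (auto simp: T_def)
  qed
  have nz: "(\<Sum>a\<in>UNIV - {0}. ?h a - B) \<noteq> 0"
    unfolding B_def by (rule sum_deviation_nonzero[OF m])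
  show ?thesis unfolding y_def[symmetric]
  proof
    assume ?two
    then have "card T = 2" using card_T by simp
    then obtain c where c: "T = {B, c}" "c \<noteq> B" using B_mem by (auto simp: card_2_iff)
    have "(\<Sum>a\<in>UNIV - {0}. (?h a - B) * (?h a - c)) = 0"
    proof (rule sum.neutral, rule ballI)
      fix a :: "'l ^ 'n" assume "a \<in> UNIV - {0}"
      then have "?h a \<in> T" by (auto simp: T_def)
      then show "(?h a - B) * (?h a - c) = 0" using c by auto
    qed
    moreover have "(\<Sum>a\<in>UNIV - {0}. (?h a - B) * (?h a - ?c)) = 0"
      unfolding B_def by (rule sum_deviation_product)
    ultimately have "(\<Sum>a\<in>UNIV - {0}. (?h a - B) * (?h a - ?c) - (?h a - B) * (?h a - c)) = 0"
      by (simp only: sum_subtractf)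
    \<comment> \<open>The two products share the factor \<open>?h a - B\<close>, so their difference
      is a constant multiple of the deviation.\<close>
    moreover have "(\<Sum>a\<in>UNIV - {0}. (?h a - B) * (?h a - ?c) - (?h a - B) * (?h a - c))
        = (c - ?c) * (\<Sum>a\<in>UNIV - {0}. ?h a - B)"
      unfolding sum_distrib_left by (rule sum.cong) (auto simp: algebra_simps)
    ultimately have "c = ?c" using nz by simp
    show "\<forall>W. vec.subspace W \<and> CARD('k)\<^sup>2 * card W = CARD('k) ^ CARD('n) \<longrightarrow>
      real (lines_in W) = y + p \<or> real (lines_in W) = y"
    proof (intro allI impI)
      fix W :: "('k ^ 'n) set" assume W: "vec.subspace W \<and> CARD('k)\<^sup>2 * card W = CARD('k) ^ CARD('n)"
      \<comment> \<open>Every \<open>(r - 2)\<close>-space is the real part of some hyperplane, so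
        the two sizes restrict all of them.\<close>
      then obtain a where a: "a \<noteq> 0" "real_part a = W" using codim_2_eq_real_part by blast
      then have "?h a \<in> {B, ?c}" using c(1) \<open>c = ?c\<close> by (auto simp: T_def)
      then show "real (lines_in W) = y + p \<or> real (lines_in W) = y"
        using h2B[of a] h2c[of a] W a(2) by auto
    qed
  next
    assume dual: "\<forall>W. vec.subspace W \<and> CARD('k)\<^sup>2 * card W = CARD('k) ^ CARD('n) \<longrightarrow>
      real (lines_in W) = y + p \<or> real (lines_in W) = y"
    have "T \<subseteq> {B, ?c}"
    proof
      fix t assume "t \<in> T"
      then obtain a where a: "a \<noteq> 0" "t = ?h a" by (auto simp: T_def)
      show "t \<in> {B, ?c}"
        using a(1)
      proof (cases rule: card_real_part)
        case 1
        then show ?thesis unfolding a(2) B_def using hyperplane_points_of_hyperplane by simp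
      next
        case 2
        then show ?thesis unfolding a(2) using h2B h2c dual subspace_real_part by blast
      qed
    qed
    \<comment> \<open>A constant size \<open>B\<close> would make the sum of deviations
      zero.\<close>
    moreover have "T \<noteq> {B}"
    proof
      assume "T = {B}"
      then have "?h a - B = 0" if "a \<in> UNIV - {0}" for a using that by (auto simp: T_def)
      then show False using nz by (simp add: sum.neutral)
    qed
    ultimately have "T = {B, ?c}" using B_mem by blast
    moreover have "B \<noteq> ?c" using k_bounds(1) p_nonzero by simp
    ultimately have "card T = 2" by simp
    then show ?two using card_T by simp
  qed
qed

end

text \<open>Geometric series. For \<open>d = -1\<close> both sides are zero, which is the case
  needed when \<open>r = 3\<close>.\<close>

lemma theta_eq: "1 < q \<Longrightarrow> real (theta d q) = (real q ^ nat (d + 1) - 1) / (real q - 1)"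
  by (simp add: theta_def geometric_sum)

theorem theorem2p3:
  fixes \<iota> :: "'k::{field,finite} \<Rightarrow> 'l::{field,finite}"
    and L :: "('k ^ 'n) set set"
    and r q m :: nat
  assumes "r \<ge> 3"
    and "CARD('n) = r + 1"
    and "CARD('k) = q"
    and "CARD('l) = q\<^sup>2"
    and "field_embedding \<iota>"
    and "m_cover r q m L"
  shows "two_character_set r (extended_points \<iota> L) \<longleftrightarrow> dual_m_cover r q m L"
proof -
  have q: "2 \<le> q" using two_le_card_field[where 'k='k] assms(3) by simp
  \<comment> \<open>The image is too small to fill the larger field, which supplies
    \<open>\<omega>\<close>.\<close>
  have "card (range \<iota>) \<le> q" using card_image_le[of UNIV \<iota>] assms(3) by simp
  also have "q < CARD('l)" using q by (simp add: assms(4) power2_eq_square)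
  finally have "range \<iota> \<noteq> UNIV" by auto
  then obtain \<omega> where "\<omega> \<notin> range \<iota>" by blast
  then interpret quadratic_extension_cover \<iota> \<omega> L m
    using assms by unfold_locales (auto simp: m_cover_def)
  obtain s where s: "r = s + 3" using assms(1) by (metis add.commute le_Suc_ex)
  have n: "CARD('n) = s + 4" using assms(2) s by simp
  interpret quadratic_extension_cover_params \<iota> \<omega> L m s "real q" "real q ^ s" "real m / (real q + 1)"
    using n q assms(3) by unfold_locales auto
  have "theta (int r - 4) q = theta (int s - 1) q" using s by simp
  then have th: "real (theta (int r - 4) q) = (real q ^ s - 1) / (real q - 1)"
    using q by (simp add: theta_eq)
  \<comment> \<open>The upper bound on \<open>m\<close> in a cover, multiplied by
    \<open>q - 1\<close>, becomes the inequality used for the deviations.\<close>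
  have "real m < real (theta (int r - 1) q)" using assms(6) by (simp add: m_cover_def)
  also have "\<dots> = (real q ^ (s + 3) - 1) / (real q - 1)" using q s by (simp add: theta_eq)
  finally have m: "real m * (real q - 1) < real q ^ s * real q ^ 3 - 1"
    using q by (simp add: assms(3) field_simps power_add)
  have W: "W \<in> n_spaces (r - 2) \<longleftrightarrow> vec.subspace W \<and> CARD('k)\<^sup>2 * card W = CARD('k) ^ CARD('n)"
    for W :: "('k ^ 'n) set"
  proof -
    have "CARD('k) ^ CARD('n) = CARD('k)\<^sup>2 * CARD('k) ^ (r - 2 + 1)"
      unfolding n s by (simp add: power_add eval_nat_numeral)
    then show ?thesis using q assms(3) by (simp add: mem_n_spaces_iff_card)
  qed
  have "two_character_set r (extended_points \<iota> L) \<longleftrightarrow> card (hyperplane_points ` (UNIV - {0})) = 2"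
    using hyperplane_points_image[OF assms(2,1)] extended_points_subset
    by (simp add: two_character_set_def)
  also have "\<dots> \<longleftrightarrow> dual_m_cover r q m L"
    unfolding two_intersection_numbers_iff[OF m] dual_m_cover_def Ball_def W
    using assms(3,6) th s by (simp add: lines_in_def add.commute mult.commute)
  finally show ?thesis .
qed

end
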